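(* Let $L=(L_t)_{t\ge0}$ be an arbitrary real-valued Lévy process and let $A>0$. For each $\gamma>0$ let $(V^\gamma,X^\gamma)$ be the solution of $$V^\gamma_t=-\gamma A\int_0^t V^\gamma_s\,ds+L_t,\qquad X^\gamma_t=\gamma\int_0^t V^\gamma_s\,ds,\qquad t\ge0 .$$ Then $A X^\gamma\to L$ in probability in $D([0,\infty),\mathbb{R})$ equipped with the Skorokhod $M_1$-topology as $\gamma\to\infty$; that is, $d_{M_1}(AX^\gamma,L)\to0$ in probability as $\gamma\to\infty$.
   Context: All processes live on a filtered probability space satisfying the usual conditions. A Lévy process starts at $0$ and has càdlàg paths; its characteristic function is $\mathbf{E}e^{iuL_t}=e^{t\Psi(u)}$ with $\Psi(u)=-\frac{\sigma^2}{2}u^2+i\mu u+\int_{\mathbb{R}\setminus\{0\}}(e^{iuy}-1-iuy\mathbf 1_{\{|y|\le1\}})\,\nu(dy)$, where $\sigma\ge0$, $\mu\in\mathbb{R}$, $\nu(\{0\})=0$ and $\int(y^2\wedge1)\,\nu(dy)<\infty$. The system has the pathwise unique solution $V^\gamma_t=\int_0^t e^{-\gamma A(t-s)}\,dL_s$, and $AX^\gamma_t=\int_0^t(1-e^{-\gamma A(t-s)})\,dL_s=L_t-V^\gamma_t$. **$M_1$-topology.** $D([0,\infty),\mathbb{R})$ is the space of real-valued càdlàg functions on $[0,\infty)$. For $x\in D([0,\infty),\mathbb{R})$ and $T>0$ the completed graph is $\Gamma_x^T=\{(x_0,0)\}\cup\{(z,t)\in\mathbb{R}\times(0,T]: z=cx_{t-}+(1-c)x_t\text{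 for some }c\in[0,1]\}$, ordered by: $(z,t)\le(z',t')$ if $t<t'$, or $t=t'$ and $|x_{t-}-z|\le|x_{t-}-z'|$. A parametric representation of $\Gamma_x^T$ is a continuous map $u\mapsto(z_u,t_u)$ from $[0,1]$ onto $\Gamma_x^T$ that is nondecreasing with respect to this order; $\Pi_x^T$ is the set of all of them. The $M_1$-topology is induced by the metric $d_{M_1}(x,x')=\int_0^\infty e^{-T}\bigl(1\wedge d_{M_1,T}(x,x')\bigr)\,dT$, where $d_{M_1,T}(x,x')=\inf\max_{u\in[0,1]}\{|z_u-z'_u|,|t_u-t'_u|\}$, the infimum being over $(z,t)\in\Pi_x^T$ and $(z',t')\in\Pi_{x'}^T$. *)

theory Defs
  imports "HOL-Probability.Probability"
begin

section \<open>Filtered probability spaces and adapted processes\<close>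

text \<open>
  Time is of type \<^typ>\<open>real\<close> and only times \<open>t \<ge> 0\<close> are meaningful. A filtration on
  \<open>[0,\<infinity>)\<close> is viewed as a library filtration by setting \<open>F t = F 0\<close> for \<open>t < 0\<close>.
\<close>

locale usual_filtered_prob_space =
  prob_space M + complete_measure M + filtration "space M" F
  for M :: "'a measure" and F :: "real \<Rightarrow> 'a measure" +
  assumes sub_F: "t \<ge> 0 \<Longrightarrow> subalgebra M (F t)"
    and null_sets_F: "null_sets M \<subseteq> sets (F 0)"
    and right_continuous_F: "t \<ge> 0 \<Longrightarrow> sets (F t) = (\<Inter>s\<in>{t<..}. sets (F s))"

definition adapted :: "(real \<Rightarrow> 'a measure) \<Rightarrow> (real \<Rightarrow> 'a \<Rightarrow> real) \<Rightarrow> bool" where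
  "adapted F Y \<longleftrightarrow> (\<forall>t\<ge>0. Y t \<in> borel_measurable (F t))"

definition cadlag :: "(real \<Rightarrow> real) \<Rightarrow> bool" where
  "cadlag x \<longleftrightarrow> (\<forall>t\<ge>0. (x \<longlongrightarrow> x t) (at_right t)) \<and> (\<forall>t>0. \<exists>l. (x \<longlongrightarrow> l) (at_left t))"


section \<open>Levy processes\<close>

definition levy_measure :: "real measure \<Rightarrow> bool" where
  "levy_measure \<nu> \<longleftrightarrow> sets \<nu> = sets borel \<and> emeasure \<nu> {0} = 0 \<and>
     (\<integral>\<^sup>+ y. ennreal (min (y\<^sup>2) 1) \<partial>\<nu>) < \<infinity>"

definition levy_exponent :: "real \<Rightarrow> real \<Rightarrow> real measure \<Rightarrow> real \<Rightarrow> complex" where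
  "levy_exponent \<sigma> \<mu> \<nu> u =
     - complex_of_real (\<sigma>\<^sup>2 / 2 * u\<^sup>2) + \<i> * complex_of_real (\<mu> * u)
     + (CLINT y : - {0} | \<nu>.
          exp (\<i> * complex_of_real (u * y)) - 1
          - \<i> * complex_of_real (u * y) * indicator {y. \<bar>y\<bar> \<le> 1} y)"

text \<open>
  Independence of the increments is required of finitely many increments of \<open>L\<close> among themselves,
  which is weaker than independence of \<open>L t - L s\<close> from \<open>F s\<close>.
\<close>

definition levy_process ::
    "'a measure \<Rightarrow> (real \<Rightarrow> 'a measure) \<Rightarrow> (real \<Rightarrow> 'a \<Rightarrow> real) \<Rightarrow> bool" where
  "levy_process M F L \<longleftrightarrow>
     adapted F L \<and>
     (\<forall>\<omega>\<in>space M. L 0 \<omega> = 0 \<and> cadlag (\<lambda>t. L t \<omega>)) \<and>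
     (\<forall>n (\<tau> :: nat \<Rightarrow> real). 0 \<le> \<tau> 0 \<and> strict_mono_on {..n} \<tau> \<longrightarrow>
        prob_space.indep_vars M (\<lambda>_. borel) (\<lambda>i \<omega>. L (\<tau> (Suc i)) \<omega> - L (\<tau> i) \<omega>) {..<n}) \<and>
     (\<forall>s t. 0 \<le> s \<and> s \<le> t \<longrightarrow>
        distr M borel (\<lambda>\<omega>. L t \<omega> - L s \<omega>) = distr M borel (L (t - s))) \<and>
     (\<exists>\<sigma> \<mu> \<nu>. 0 \<le> \<sigma> \<and> levy_measure \<nu> \<and>
        (\<forall>t\<ge>0. \<forall>u. char (distr M borel (L t)) u
           = exp (complex_of_real t * levy_exponent \<sigma> \<mu> \<nu> u)))"


section \<open>The Skorokhod M1 metric\<close>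

abbreviation left_lim :: "(real \<Rightarrow> real) \<Rightarrow> real \<Rightarrow> real" where
  "left_lim x t \<equiv> Lim (at_left t) x"

definition completed_graph :: "(real \<Rightarrow> real) \<Rightarrow> real \<Rightarrow> (real \<times> real) set" where
  "completed_graph x T = {(x 0, 0)} \<union>
     {(z, t). 0 < t \<and> t \<le> T \<and> (\<exists>c\<in>{0..1}. z = c * left_lim x t + (1 - c) * x t)}"

text \<open>
  For \<open>t = t' = 0\<close> the term \<open>left_lim x 0\<close> is unspecified, but this is harmless: the only
  point of the completed graph over time \<open>0\<close> is \<open>(x 0, 0)\<close>.
\<close>

definition graph_le :: "(real \<Rightarrow> real) \<Rightarrow> real \<times> real \<Rightarrow> real \<times> real \<Rightarrow> bool" where
  "graph_le x p q \<longleftrightarrow> (case (p, q) of ((z, t), (z', t')) \<Rightarrow>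
     t < t' \<or> (t = t' \<and> \<bar>left_lim x t - z\<bar> \<le> \<bar>left_lim x t - z'\<bar>))"

definition parametric_reps :: "(real \<Rightarrow> real) \<Rightarrow> real \<Rightarrow> (real \<Rightarrow> real \<times> real) set" where
  "parametric_reps x T =
     {p. continuous_on {0..1} p \<and> p ` {0..1} = completed_graph x T \<and>
         (\<forall>u\<in>{0..1}. \<forall>v\<in>{0..1}. u \<le> v \<longrightarrow> graph_le x (p u) (p v))}"

definition m1_dist_upto :: "real \<Rightarrow> (real \<Rightarrow> real) \<Rightarrow> (real \<Rightarrow> real) \<Rightarrow> real" where
  "m1_dist_upto T x y =
     (INF (p, q) \<in> parametric_reps x T \<times> parametric_reps y T.
        SUP u\<in>{0..1}. max \<bar>fst (p u) - fst (q u)\<bar> \<bar>snd (p u) - snd (q u)\<bar>)"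

definition m1_dist :: "(real \<Rightarrow> real) \<Rightarrow> (real \<Rightarrow> real) \<Rightarrow> real" where
  "m1_dist x y = (LINT T:{0<..}|lborel. exp (- T) * min 1 (m1_dist_upto T x y))"


section \<open>Convergence in probability in the M1 topology\<close>

text \<open>
  The outer measure coincides with the measure of the event whenever the distance is a random
  variable; unlike \<^const>\<open>measure\<close>, it does not default to \<open>0\<close> on sets that are not known to
  be measurable.
\<close>

definition tendsto_in_prob_M1 ::
    "'a measure \<Rightarrow> ('i \<Rightarrow> real \<Rightarrow> 'a \<Rightarrow> real) \<Rightarrow> (real \<Rightarrow> 'a \<Rightarrow> real) \<Rightarrow> 'i filter \<Rightarrow> bool" where
  "tendsto_in_prob_M1 M Y Z G \<longleftrightarrow>
     (\<forall>\<epsilon>>0. ((\<lambda>i. outer_measure_of M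
        {\<omega> \<in> space M. m1_dist (\<lambda>t. Y i t \<omega>) (\<lambda>t. Z t \<omega>) > \<epsilon>}) \<longlongrightarrow> 0) G)"

end

theory Submission
  imports Defs
begin

text \<open>
  Write \<open>y = A X\<close> and \<open>\<lambda> = \<gamma> A\<close>. Since \<open>V = L - y\<close>, the path \<open>y\<close> solves
  \<open>y(t) = \<lambda> \<integral>\<^sub>0\<^sup>t (L - y) ds\<close>: it is the exponential smoothing of \<open>L\<close> at rate \<open>\<lambda>\<close>. The theorem is a
  statement about a single cadlag path \<open>x\<close> and its smoothing \<open>y\<close>, made uniform over measurable
  events of paths.

  For one path the mechanism is relaxation (lemma \<open>relax\<close>): while \<open>x\<close> stays within \<open>e\<close> of a level
  \<open>b\<close>, the difference \<open>y - b\<close> decays like \<open>exp (- \<lambda> t)\<close> up to an error \<open>e\<close>. Hence, once \<open>\<lambda>\<close> is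
  large, \<open>y\<close> is close to \<open>x\<close> except on a short window \<open>[\<tau>, \<tau> + h]\<close> after a large jump \<open>\<tau>\<close>, and there
  it runs almost monotonically from the level before the jump to the level after it. In the
  M1 topology such a run is matched with the vertical segment of the completed graph of \<open>x\<close> at \<open>\<tau>\<close>:
  the point that has covered the fraction \<open>c\<close> of the jump is paired with the time \<open>\<tau> + catch_up h c\<close>
  at which the relaxation has covered this fraction, and afterwards the time \<open>\<tau> + h\<close> is held until
  the time component of the graph has reached it. This pairing is a continuous nondecreasing time
  change on the completed graph, and composing any parametric representation of \<open>x\<close> with it
  yields a parametric representation of \<open>y\<close> (\<open>m1_dist_upto_le\<close>, \<open>m1_dist_upto_smoothed\<close>). It fails
  only for horizons \<open>T\<close> in one of the windows, whose total length is small, so integrating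
  over \<open>T\<close> bounds the full distance (\<open>m1_dist_smoothed\<close>).

  The infimum that defines the distance is informative only if parametric representations
  exist. They are obtained by inverting a continuous, strictly increasing height function
  on the compact completed graph (\<open>parametric_rep_exists\<close>).

  The oscillation of the path enters through the three-point modulus of Billingsley,
  \<open>min \<bar>x s - x r\<bar> \<bar>x t - x s\<bar> \<le> e\<close> for \<open>r \<le> s \<le> t\<close> with \<open>t - r < d\<close>. On a bounded time interval it is
  small for every cadlag path when \<open>d\<close> is, it forces large jumps to be at
  least \<open>d\<close> apart, and by right continuity it can be tested on rational times. So the paths that satisfy a given modulus and sup bound form
  a measurable event \<open>E n\<close>, on which the estimate is uniform, and these events increase to the
  whole space. This uniformity is what controls the outer probability: a pointwise limit
  along the continuous parameter \<open>\<gamma>\<close> would not suffice for distances that need not be measurable.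
\<close>

section \<open>Oscillations and jumps of a cadlag path\<close>

lemma cadlag_left_lim:
  assumes "cadlag x" "0 < t"
  shows "(x \<longlongrightarrow> left_lim x t) (at_left t)"
proof -
  obtain l where l: "(x \<longlongrightarrow> l) (at_left t)"
    using assms unfolding cadlag_def by blast
  moreover have "left_lim x t = l"
    by (rule tendsto_Lim[OF _ l]) simp
  ultimately show ?thesis by simp
qed

lemma cadlag_near_left:
  assumes "cadlag x" "0 < t" "0 < e"
  obtains h where "0 < h" "h \<le> t" "\<And>s. t - h < s \<Longrightarrow> s < t \<Longrightarrow> \<bar>x s - left_lim x t\<bar> < e"
proof -
  have "\<forall>\<^sub>F s in at_left t. \<bar>x s - left_lim x t\<bar> < e"
    using tendstoD[OF cadlag_left_lim[OF assms(1,2)] assms(3)] by (simp add: dist_real_def)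
  then obtain b where b: "b < t" "\<And>s. b < s \<Longrightarrow> s < t \<Longrightarrow> \<bar>x s - left_lim x t\<bar> < e"
    unfolding eventually_at_left_field by blast
  show ?thesis
  proof (rule that[of "min t (t - b)"])
    show "0 < min t (t - b)" using b(1) assms by simp
  qed (use b in auto)
qed

lemma cadlag_near_right:
  assumes "cadlag x" "0 \<le> t" "0 < e"
  obtains h where "0 < h" "\<And>s. t \<le> s \<Longrightarrow> s < t + h \<Longrightarrow> \<bar>x s - x t\<bar> < e"
proof -
  have "(x \<longlongrightarrow> x t) (at_right t)"
    using assms unfolding cadlag_def by blast
  then have "\<forall>\<^sub>F s in at_right t. \<bar>x s - x t\<bar> < e"
    using tendstoD[OF _ assms(3)] by (fastforce simp: dist_real_def)
  then obtain b where b: "b > t" "\<And>s. t < s \<Longrightarrow> s < b \<Longrightarrow> \<bar>x s - x t\<bar> < e"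
    unfolding eventually_at_right_field by blast
  show ?thesis
  proof (rule that[of "b - t"])
    fix s assume "t \<le> s" "s < t + (b - t)"
    then show "\<bar>x s - x t\<bar> < e"
      using b(2)[of s] assms(3) by (cases "s = t") auto
  qed (use b(1) in simp)
qed

lemma cadlag_near:
  assumes "cadlag x" "0 \<le> t" "0 < e"
  obtains h where "0 < h" "\<And>s. 0 \<le> s \<Longrightarrow> t - h < s \<Longrightarrow> s < t \<Longrightarrow> \<bar>x s - left_lim x t\<bar> < e"
    "\<And>s. t \<le> s \<Longrightarrow> s < t + h \<Longrightarrow> \<bar>x s - x t\<bar> < e"
proof -
  obtain h1 where h1: "0 < h1" "\<And>s. t \<le> s \<Longrightarrow> s < t + h1 \<Longrightarrow> \<bar>x s - x t\<bar> < e"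
    using cadlag_near_right[OF assms] by blast
  show ?thesis
  proof (cases "t = 0")
    case True
    show ?thesis by (rule that[OF h1(1) _ h1(2)]) (use True in auto)
  next
    case False
    then have "0 < t" using assms by simp
    then obtain h2 where h2: "0 < h2" "h2 \<le> t"
      "\<And>s. t - h2 < s \<Longrightarrow> s < t \<Longrightarrow> \<bar>x s - left_lim x t\<bar> < e"
      using cadlag_near_left[OF assms(1) _ assms(3)] by metis
    show ?thesis
      by (rule that[of "min h1 h2"]) (use h1 h2 in auto)
  qed
qed

lemma left_lim_between:
  assumes "cadlag x" "0 < t" "a < t" "\<And>s. a < s \<Longrightarrow> s < t \<Longrightarrow> \<bar>x s - c\<bar> \<le> e"
  shows "\<bar>left_lim x t - c\<bar> \<le> e"
proof (rule tendsto_upperbound)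
  show "((\<lambda>s. \<bar>x s - c\<bar>) \<longlongrightarrow> \<bar>left_lim x t - c\<bar>) (at_left t)"
    by (intro tendsto_intros cadlag_left_lim assms)
  show "\<forall>\<^sub>F s in at_left t. \<bar>x s - c\<bar> \<le> e"
    unfolding eventually_at_left_field using assms by blast
qed simp

lemma right_lim_between:
  assumes "cadlag x" "0 \<le> t" "t < b" "\<And>s. t < s \<Longrightarrow> s < b \<Longrightarrow> \<bar>x s - c\<bar> \<le> e"
  shows "\<bar>x t - c\<bar> \<le> e"
proof (rule tendsto_upperbound)
  have "(x \<longlongrightarrow> x t) (at_right t)" using assms unfolding cadlag_def by blast
  then show "((\<lambda>s. \<bar>x s - c\<bar>) \<longlongrightarrow> \<bar>x t - c\<bar>) (at_right t)"
    by (intro tendsto_intros)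
  show "\<forall>\<^sub>F s in at_right t. \<bar>x s - c\<bar> \<le> e"
    unfolding eventually_at_right_field using assms by blast
qed simp

text \<open>
  A bound on Billingsley's modulus \<open>w''\<close>. Unlike the moduli defined through partitions, this one is
  a supremum over points, and by right continuity over rational ones, so it is measurable as a
  function of the path.
\<close>

definition three_point_bound :: "real \<Rightarrow> real \<Rightarrow> real \<Rightarrow> (real \<Rightarrow> real) \<Rightarrow> bool" where
  "three_point_bound K d e x \<longleftrightarrow>
     (\<forall>r s t. 0 \<le> r \<and> r \<le> s \<and> s \<le> t \<and> t < K \<and> t - r < d \<longrightarrow> \<bar>x s - x r\<bar> \<le> e \<or> \<bar>x t - x s\<bar> \<le> e)"

text \<open>
  The Lebesgue number of the cover of \<open>[0, K]\<close> by the neighbourhoods in which the path is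
  close to its one-sided limits at the centre: at scale \<open>d\<close> the path looks like a step function with
  a single step.
\<close>

lemma cadlag_uniform_one_sided_approx:
  assumes "cadlag x" "0 < e"
  obtains d where "0 < d"
    "\<And>r. 0 \<le> r \<Longrightarrow> r \<le> K \<Longrightarrow> \<exists>t\<ge>0. \<forall>s. 0 \<le> s \<longrightarrow> \<bar>s - r\<bar> < d \<longrightarrow>
       (s < t \<longrightarrow> \<bar>x s - left_lim x t\<bar> < e) \<and> (t \<le> s \<longrightarrow> \<bar>x s - x t\<bar> < e)"
proof -
  define P where "P t h \<longleftrightarrow> (\<forall>s. 0 \<le> s \<longrightarrow> \<bar>s - t\<bar> < h \<longrightarrow>
       (s < t \<longrightarrow> \<bar>x s - left_lim x t\<bar> < e) \<and> (t \<le> s \<longrightarrow> \<bar>x s - x t\<bar> < e))" for t h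
  have "\<exists>h>0. P t h" if t0: "0 \<le> t" for t
  proof -
    obtain h where "0 < h" "\<And>s. 0 \<le> s \<Longrightarrow> t - h < s \<Longrightarrow> s < t \<Longrightarrow> \<bar>x s - left_lim x t\<bar> < e"
      "\<And>s. t \<le> s \<Longrightarrow> s < t + h \<Longrightarrow> \<bar>x s - x t\<bar> < e"
      using cadlag_near[OF assms(1) t0 assms(2)] by metis
    then show ?thesis unfolding P_def by (intro exI[of _ h]) auto
  qed
  then obtain h where h: "\<And>t. 0 \<le> t \<Longrightarrow> 0 < h t \<and> P t (h t)" by metis
  define G where "G = (\<lambda>t. ball t (h t)) ` {0..K}"
  have sub: "{0..K} \<subseteq> \<Union> G"
    using h unfolding G_def by force
  obtain d where d: "0 < d" "\<And>r. r \<in> {0..K} \<Longrightarrow> \<exists>g\<in>G. ball r d \<subseteq> g"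
    by (rule Heine_Borel_lemma[OF compact_Icc sub]) (auto simp: G_def)
  show ?thesis
  proof (rule that[OF d(1)])
    fix r :: real assume "0 \<le> r" "r \<le> K"
    then obtain t where t: "t \<in> {0..K}" "ball r d \<subseteq> ball t (h t)"
      using d(2)[of r] unfolding G_def by auto
    have "P t (h t)" using h t by auto
    moreover have "\<bar>s - t\<bar> < h t" if "\<bar>s - r\<bar> < d" for s
      using t(2) that by (force simp: dist_real_def subset_iff abs_minus_commute)
    ultimately show "\<exists>t\<ge>0. \<forall>s. 0 \<le> s \<longrightarrow> \<bar>s - r\<bar> < d \<longrightarrow>
       (s < t \<longrightarrow> \<bar>x s - left_lim x t\<bar> < e) \<and> (t \<le> s \<longrightarrow> \<bar>x s - x t\<bar> < e)"
      using t(1) unfolding P_def by (intro exI[of _ t]) auto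
  qed
qed

text \<open>
  Three points at scale \<open>d\<close> are distributed over the two sides of a single step, so the middle
  one shares a side with one of its neighbours.
\<close>

lemma cadlag_imp_three_point_bound:
  assumes "cadlag x" "0 < e"
  obtains d where "0 < d" "three_point_bound K d e x"
proof -
  obtain d where d: "0 < d"
    "\<And>r. 0 \<le> r \<Longrightarrow> r \<le> K \<Longrightarrow> \<exists>t\<ge>0. \<forall>s. 0 \<le> s \<longrightarrow> \<bar>s - r\<bar> < d \<longrightarrow>
       (s < t \<longrightarrow> \<bar>x s - left_lim x t\<bar> < e/2) \<and> (t \<le> s \<longrightarrow> \<bar>x s - x t\<bar> < e/2)"
    by (rule cadlag_uniform_one_sided_approx[OF assms(1), of "e/2"]) (use assms in auto)
  show ?thesis
  proof (rule that[OF d(1)], unfold three_point_bound_def, intro allI impI)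
    fix r s t assume *: "0 \<le> r \<and> r \<le> s \<and> s \<le> t \<and> t < K \<and> t - r < d"
    then obtain u where u: "\<And>q. 0 \<le> q \<Longrightarrow> \<bar>q - r\<bar> < d \<Longrightarrow>
       (q < u \<longrightarrow> \<bar>x q - left_lim x u\<bar> < e/2) \<and> (u \<le> q \<longrightarrow> \<bar>x q - x u\<bar> < e/2)"
      using d(2)[of r] by (metis order.strict_implies_order order_trans)
    show "\<bar>x s - x r\<bar> \<le> e \<or> \<bar>x t - x s\<bar> \<le> e"
    proof (cases "s < u")
      case True
      then have "\<bar>x s - left_lim x u\<bar> < e/2" "\<bar>x r - left_lim x u\<bar> < e/2"
        using u[of s] u[of r] * by auto
      then show ?thesis by linarith
    next
      case False
      then have "\<bar>x s - x u\<bar> < e/2" "\<bar>x t - x u\<bar> < e/2"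
        using u[of s] u[of t] * by auto
      then show ?thesis by linarith
    qed
  qed
qed

lemma cadlag_bounded:
  assumes "cadlag x"
  obtains B where "0 < B" "\<And>s. 0 \<le> s \<Longrightarrow> s \<le> K \<Longrightarrow> \<bar>x s\<bar> \<le> B"
proof -
  obtain d where d: "0 < d"
    "\<And>r. 0 \<le> r \<Longrightarrow> r \<le> K \<Longrightarrow> \<exists>t\<ge>0. \<forall>s. 0 \<le> s \<longrightarrow> \<bar>s - r\<bar> < d \<longrightarrow>
       (s < t \<longrightarrow> \<bar>x s - left_lim x t\<bar> < 1) \<and> (t \<le> s \<longrightarrow> \<bar>x s - x t\<bar> < 1)"
    by (rule cadlag_uniform_one_sided_approx[OF assms(1), of 1]) auto
  then obtain g where g: "\<And>r s. 0 \<le> r \<Longrightarrow> r \<le> K \<Longrightarrow> 0 \<le> s \<Longrightarrow> \<bar>s - r\<bar> < d \<Longrightarrow>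
       (s < g r \<longrightarrow> \<bar>x s - left_lim x (g r)\<bar> < 1) \<and> (g r \<le> s \<longrightarrow> \<bar>x s - x (g r)\<bar> < 1)"
    by metis
  obtain N where N: "finite N" "N \<subseteq> {0..K}" "{0..K} \<subseteq> (\<Union>r\<in>N. ball r d)"
    using compactE_image[OF compact_Icc, of "{0..K}" "\<lambda>r. ball r d" 0 K] d(1) by force
  define B where "B = 1 + (\<Sum>r\<in>N. \<bar>left_lim x (g r)\<bar> + \<bar>x (g r)\<bar> + 1)"
  show ?thesis
  proof (rule that[of B])
    show "0 < B" unfolding B_def by (smt (verit) sum_nonneg abs_ge_zero)
    fix s assume s: "0 \<le> s" "s \<le> K"
    then obtain r where r: "r \<in> N" "s \<in> ball r d" using N(3) by auto
    then have r': "0 \<le> r" "r \<le> K" using N by auto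
    have "\<bar>left_lim x (g r)\<bar> + \<bar>x (g r)\<bar> + 1 \<le> (\<Sum>r\<in>N. \<bar>left_lim x (g r)\<bar> + \<bar>x (g r)\<bar> + 1)"
      by (rule member_le_sum[OF r(1) _ N(1)]) auto
    moreover have "\<bar>s - r\<bar> < d" using r(2) by (simp add: dist_real_def abs_minus_commute)
    ultimately show "\<bar>x s\<bar> \<le> B"
      using g[OF r' s(1)] unfolding B_def by (cases "s < g r") auto
  qed
qed

abbreviation jump :: "(real \<Rightarrow> real) \<Rightarrow> real \<Rightarrow> real" where
  "jump x t \<equiv> x t - left_lim x t"

text \<open>
  If the endpoint values are far apart, every intermediate value is close to exactly one of
  them, and the three-point bound forbids a return to the first one. The path thus switches once,
  at the supremum of the times with values close to \<open>x r\<close>, and the switch is a large jump.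
\<close>

lemma three_point_bound_small_jumps:
  assumes "cadlag x" and tp: "three_point_bound K d e x"
    and rt: "0 \<le> r" "r \<le> t" "t < K" "t - r < d" and e: "0 < e"
    and small: "\<And>s. r < s \<Longrightarrow> s \<le> t \<Longrightarrow> \<bar>jump x s\<bar> \<le> 2 * e"
  shows "\<bar>x t - x r\<bar> \<le> 4 * e"
proof (rule ccontr)
  assume "\<not> ?thesis"
  then have big: "\<bar>x t - x r\<bar> > 4 * e" by simp
  have tpD: "\<bar>x s - x q\<bar> \<le> e \<or> \<bar>x s' - x s\<bar> \<le> e" if "r \<le> q" "q \<le> s" "s \<le> s'" "s' \<le> t" for q s s'
    using tp that rt unfolding three_point_bound_def by auto
  define A where "A = {s \<in> {r..t}. \<bar>x s - x r\<bar> \<le> e}"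
  have rA: "r \<in> A" using rt e by (simp add: A_def)
  have bdd: "bdd_above A" unfolding A_def by (auto intro: bdd_aboveI[of _ t])
  define u where "u = Sup A"
  have u: "r \<le> u" "u \<le> t"
    unfolding u_def
    by (rule cSup_upper[OF rA bdd], rule cSup_least, use rA in blast, simp add: A_def)
  have notA: "\<bar>x t - x s\<bar> \<le> e" if "s \<in> {r..t}" "s \<notin> A" for s
    using tpD[of r s t] that unfolding A_def by auto
  have up: "s' \<notin> A" if "s \<in> {r..t}" "s \<notin> A" "s \<le> s'" "s' \<le> t" for s s'
  proof -
    have "\<bar>x s' - x s\<bar> \<le> e" using tpD[of r s s'] that unfolding A_def by auto
    with notA[OF that(1,2)] big show ?thesis unfolding A_def by auto
  qed
  have below: "s \<in> A" if s: "r \<le> s" "s < u" for s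
  proof (rule ccontr)
    assume "s \<notin> A"
    obtain a where "a \<in> A" "s < a"
      using less_cSupD[of A s] s(2) rA unfolding u_def by blast
    then show False using up[of s a] \<open>s \<notin> A\<close> s u by (auto simp: A_def)
  qed
  have above: "s \<notin> A" if "u < s" for s
    using cSup_upper[OF _ bdd, of s] that unfolding u_def by fastforce
  have "u \<notin> A"
  proof
    assume uA: "u \<in> A"
    then have "u \<noteq> t" using big e by (auto simp: A_def)
    then have "u < t" using u by simp
    have "\<bar>x u - x t\<bar> \<le> e"
    proof (rule right_lim_between[OF assms(1) _ \<open>u < t\<close>])
      fix s assume "u < s" "s < t"
      then show "\<bar>x s - x t\<bar> \<le> e" using notA[of s] above[of s] u by (auto simp: abs_minus_commute)
    qed (use u rt in simp)
    with uA big e show False unfolding A_def by auto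
  qed
  then have "r \<noteq> u" using rA by auto
  then have "r < u" using u by simp
  have "\<bar>left_lim x u - x r\<bar> \<le> e"
    by (rule left_lim_between[OF assms(1) _ \<open>r < u\<close>]) (use below \<open>r < u\<close> rt in \<open>auto simp: A_def\<close>)
  moreover have "\<bar>x t - x u\<bar> \<le> e" using notA[of u] u \<open>u \<notin> A\<close> by auto
  ultimately show False using small[OF \<open>r < u\<close> u(2)] big by auto
qed

text \<open>
  The jump at \<open>t1\<close> rules out the first alternative of the three-point bound for triples \<open>r, t1, q\<close> with \<open>r\<close>
  just before \<open>t1\<close>. So the path stays within \<open>e\<close> of \<open>x t1\<close> up to \<open>t2\<close>, and the jump at \<open>t2\<close> is the
  difference of two such values.
\<close>

lemma large_jumps_separated:
  assumes "cadlag x" and tp: "three_point_bound K d e x" and e: "0 < e"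
    and ts: "0 < t1" "t1 < t2" "t2 < K" "t2 - t1 < d" and j: "2 * e < \<bar>jump x t1\<bar>"
  shows "\<bar>jump x t2\<bar> \<le> 2 * e"
proof -
  have near: "\<bar>x q - x t1\<bar> \<le> e" if q: "t1 < q" "q \<le> t2" for q
  proof -
    obtain h where h: "0 < h" "h \<le> t1" "\<And>s. t1 - h < s \<Longrightarrow> s < t1 \<Longrightarrow> \<bar>x s - left_lim x t1\<bar> < e"
      using cadlag_near_left[OF assms(1) ts(1) e] by metis
    define r where "r = t1 - min h (d - (t2 - t1)) / 2"
    have r: "0 \<le> r" "r < t1" "t1 - h < r" "t2 - r < d"
      using h ts unfolding r_def by (auto simp: min_def field_simps)
    have "\<bar>x t1 - x r\<bar> \<le> e \<or> \<bar>x q - x t1\<bar> \<le> e"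
      using tp r q ts unfolding three_point_bound_def
      by (meson less_imp_le le_less_trans diff_right_mono order_trans)
    then show ?thesis using h(3)[OF r(3,2)] j by auto
  qed
  have "\<bar>left_lim x t2 - x t1\<bar> \<le> e"
    by (rule left_lim_between[OF assms(1) _ ts(2)]) (use near ts in auto)
  then show ?thesis using near[of t2] ts by auto
qed

text \<open>
  Separated points lie in different cells of a grid of mesh \<open>d\<close>.
\<close>

lemma large_jumps_finite:
  assumes "cadlag x" and tp: "three_point_bound K d e x" and e: "0 < e" and d: "0 < d" and "T < K"
  shows "finite {t \<in> {0<..T}. 2 * e < \<bar>jump x t\<bar>}"
    and "real (card {t \<in> {0<..T}. 2 * e < \<bar>jump x t\<bar>}) \<le> \<bar>K\<bar> / d + 1"
proof -
  let ?J = "{t \<in> {0<..T}. 2 * e < \<bar>jump x t\<bar>}"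
  let ?f = "\<lambda>t. nat \<lfloor>t / d\<rfloor>"
  have inj: "inj_on ?f ?J"
  proof (rule linorder_inj_onI)
    fix s t assume st: "s < t" "s \<in> ?J" "t \<in> ?J"
    have "\<not> t - s < d"
      using large_jumps_separated[OF assms(1) tp e, of s t] st \<open>T < K\<close> by auto
    then have "(s + d) / d \<le> t / d" using d by (intro divide_right_mono) auto
    then have "s / d + 1 \<le> t / d" using d by (simp add: add_divide_distrib)
    then have "\<lfloor>s / d\<rfloor> < \<lfloor>t / d\<rfloor>" by linarith
    moreover have "0 \<le> \<lfloor>s / d\<rfloor>" using st d by simp
    ultimately show "?f s \<noteq> ?f t" by linarith
  qed (auto simp: linear)
  have sub: "?f ` ?J \<subseteq> {..nat \<lfloor>\<bar>K\<bar> / d\<rfloor>}"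
  proof (rule image_subsetI)
    fix t assume "t \<in> ?J"
    then have "t / d \<le> \<bar>K\<bar> / d" using \<open>T < K\<close> d by (simp add: divide_right_mono)
    then show "?f t \<in> {..nat \<lfloor>\<bar>K\<bar> / d\<rfloor>}" by (simp add: floor_mono nat_mono)
  qed
  show fin: "finite ?J" using inj sub by (meson finite_atMost finite_imageD finite_subset)
  have "card ?J = card (?f ` ?J)" using inj by (simp add: card_image)
  also have "\<dots> \<le> Suc (nat \<lfloor>\<bar>K\<bar> / d\<rfloor>)" using card_mono[OF finite_atMost sub] by simp
  finally have "real (card ?J) \<le> real (nat \<lfloor>\<bar>K\<bar> / d\<rfloor>) + 1" by linarith
  moreover have "real (nat \<lfloor>\<bar>K\<bar> / d\<rfloor>) \<le> \<bar>K\<bar> / d" using d by (simp add: of_nat_floor)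
  ultimately show "real (card ?J) \<le> \<bar>K\<bar> / d + 1" by linarith
qed

lemma cadlag_countable_jumps:
  assumes "cadlag x"
  shows "countable {t \<in> {0<..T}. jump x t \<noteq> 0}"
proof -
  have fin: "finite {t \<in> {0<..T}. 2 * (1 / Suc n) < \<bar>jump x t\<bar>}" for n :: nat
  proof -
    obtain d where "0 < d" "three_point_bound (T + 1) d (1 / Suc n) x"
      by (rule cadlag_imp_three_point_bound[OF assms, of "1 / Suc n"]) auto
    then show ?thesis using large_jumps_finite(1)[OF assms, of "T + 1" d "1 / Suc n" T] by auto
  qed
  have "{t \<in> {0<..T}. jump x t \<noteq> 0} \<subseteq> (\<Union>n. {t \<in> {0<..T}. 2 * (1 / Suc n) < \<bar>jump x t\<bar>})"
  proof
    fix t assume t: "t \<in> {t \<in> {0<..T}. jump x t \<noteq> 0}"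
    then obtain n where n: "inverse (real (Suc n)) < \<bar>jump x t\<bar> / 2"
      using reals_Archimedean[of "\<bar>jump x t\<bar> / 2"] by auto
    have "2 * a < b" if "a < b / 2" for a b :: real using that by simp
    from this[OF n] have "2 * (1 / Suc n) < \<bar>jump x t\<bar>" by (simp only: inverse_eq_divide)
    with t show "t \<in> (\<Union>n. {t \<in> {0<..T}. 2 * (1 / Suc n) < \<bar>jump x t\<bar>})" by blast
  qed
  moreover have "countable (\<Union>n. {t \<in> {0<..T}. 2 * (1 / Suc n) < \<bar>jump x t\<bar>})"
    using fin by (intro countable_UN) (auto intro: countable_finite)
  ultimately show ?thesis by (rule countable_subset)
qed

section \<open>The completed graph\<close>

text \<open>
  The fibre over \<open>t = 0\<close> is set apart because \<open>left_lim x 0\<close> is unspecified.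
\<close>

definition fibre :: "(real \<Rightarrow> real) \<Rightarrow> real \<Rightarrow> real set" where
  "fibre x t = (if t = 0 then {x 0} else closed_segment (left_lim x t) (x t))"

lemma completed_graph_iff:
  assumes "0 \<le> T"
  shows "P \<in> completed_graph x T \<longleftrightarrow> 0 \<le> snd P \<and> snd P \<le> T \<and> fst P \<in> fibre x (snd P)"
proof -
  have seg: "(\<exists>c\<in>{0..1}. z = c * a + (1 - c) * b) \<longleftrightarrow> z \<in> closed_segment a b" for z a b :: real
  proof
    assume "\<exists>c\<in>{0..1}. z = c * a + (1 - c) * b"
    then obtain c where "c \<in> {0..1}" "z = c * a + (1 - c) * b" by blast
    then show "z \<in> closed_segment a b"
      unfolding in_segment by (intro exI[of _ "1 - c"]) auto
  next
    assume "z \<in> closed_segment a b"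
    then obtain u where "0 \<le> u" "u \<le> 1" "z = (1 - u) * a + u * b"
      unfolding in_segment by auto
    then show "\<exists>c\<in>{0..1}. z = c * a + (1 - c) * b"
      by (intro bexI[of _ "1 - u"]) auto
  qed
  show ?thesis
    using assms unfolding completed_graph_def fibre_def by (cases P) (auto simp: seg)
qed

lemma fibre_ends:
  shows "x t \<in> fibre x t" and "0 < t \<Longrightarrow> left_lim x t \<in> fibre x t"
  unfolding fibre_def by auto

lemma closed_fibre: "closed (fibre x t)"
  unfolding fibre_def by auto

lemma fibre_near:
  assumes "z \<in> fibre x t" "\<bar>x t - c\<bar> \<le> e" "0 < t \<Longrightarrow> \<bar>left_lim x t - c\<bar> \<le> e" "0 \<le> t"
  shows "\<bar>z - c\<bar> \<le> e"
proof (cases "t = 0")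
  case False
  then have "z \<in> closed_segment (left_lim x t) (x t)" using assms by (simp add: fibre_def)
  moreover have "closed_segment (left_lim x t) (x t) \<subseteq> cball c e"
    using assms False by (intro closed_segment_subset) (auto simp: dist_real_def abs_minus_commute)
  ultimately show ?thesis by (auto simp: dist_real_def abs_minus_commute)
qed (use assms in \<open>auto simp: fibre_def\<close>)

lemma fibre_dist_le_jump:
  assumes "z \<in> fibre x t" "t \<noteq> 0"
  shows "\<bar>z - left_lim x t\<bar> \<le> \<bar>jump x t\<bar>"
  using assms unfolding fibre_def by (auto simp: closed_segment_eq_real_ivl split: if_splits)

lemma graph_near_left:
  assumes "cadlag x" "0 < t" "0 < e"
  obtains h where "0 < h"
    "\<And>z s. z \<in> fibre x s \<Longrightarrow> 0 \<le> s \<Longrightarrow> t - h < s \<Longrightarrow> s < t \<Longrightarrow> \<bar>z - left_lim x t\<bar> \<le> e"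
proof -
  obtain h where h: "0 < h" "h \<le> t" "\<And>s. t - h < s \<Longrightarrow> s < t \<Longrightarrow> \<bar>x s - left_lim x t\<bar> < e"
    using cadlag_near_left[OF assms] by metis
  show ?thesis
  proof (rule that[OF h(1)])
    fix z s assume s: "z \<in> fibre x s" "0 \<le> s" "t - h < s" "s < t"
    have "\<bar>left_lim x s - left_lim x t\<bar> \<le> e" if "0 < s"
    proof (rule left_lim_between[OF assms(1) that, of "t - h"])
      show "\<bar>x q - left_lim x t\<bar> \<le> e" if "t - h < q" "q < s" for q
        using h(3)[of q] that s by linarith
    qed (use s in simp)
    then show "\<bar>z - left_lim x t\<bar> \<le> e"
      using fibre_near[OF s(1)] h(3)[OF s(3,4)] s(2) by fastforce
  qed
qed

lemma graph_near_right:
  assumes "cadlag x" "0 \<le> t" "0 < e"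
  obtains h where "0 < h"
    "\<And>z s. z \<in> fibre x s \<Longrightarrow> t < s \<Longrightarrow> s < t + h \<Longrightarrow> \<bar>z - x t\<bar> \<le> e"
proof -
  obtain h where h: "0 < h" "\<And>s. t \<le> s \<Longrightarrow> s < t + h \<Longrightarrow> \<bar>x s - x t\<bar> < e"
    using cadlag_near_right[OF assms] by metis
  show ?thesis
  proof (rule that[OF h(1)])
    fix z s assume s: "z \<in> fibre x s" "t < s" "s < t + h"
    have "\<bar>left_lim x s - x t\<bar> \<le> e" if "0 < s"
    proof (rule left_lim_between[OF assms(1) that s(2)])
      show "\<bar>x q - x t\<bar> \<le> e" if "t < q" "q < s" for q
        using h(2)[of q] that s by linarith
    qed
    then show "\<bar>z - x t\<bar> \<le> e"
      using fibre_near[OF s(1)] h(2)[of s] s assms(2) by fastforce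
  qed
qed

text \<open>
  Closedness is upper semicontinuity of the fibres: near time \<open>t\<close> the earlier fibres
  accumulate at the left limit and the later ones at the value, and both belong to the fibre over \<open>t\<close>.
\<close>

lemma compact_completed_graph:
  assumes "cadlag x" "0 \<le> T"
  shows "compact (completed_graph x T)"
  unfolding compact_eq_bounded_closed
proof
  obtain B where B: "0 < B" "\<And>s. 0 \<le> s \<Longrightarrow> s \<le> T \<Longrightarrow> \<bar>x s\<bar> \<le> B"
    using cadlag_bounded[OF assms(1)] by metis
  have "\<bar>z\<bar> \<le> B" if z: "z \<in> fibre x t" "0 \<le> t" "t \<le> T" for z t
  proof -
    have "\<bar>left_lim x t - 0\<bar> \<le> B" if "0 < t"
      by (rule left_lim_between[OF assms(1) that that]) (use B(2) z in auto)
    then show ?thesis using fibre_near[OF z(1), of 0 B] B(2)[OF z(2,3)] z by auto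
  qed
  then have "completed_graph x T \<subseteq> {-B..B} \<times> {0..T}"
    using completed_graph_iff[OF assms(2), of _ x] by (fastforce simp: abs_le_iff)
  then show "bounded (completed_graph x T)"
    by (rule bounded_subset[rotated]) (intro bounded_Times bounded_closed_interval)
  show "closed (completed_graph x T)"
    unfolding closed_sequential_limits
  proof (intro allI impI, elim conjE)
    fix p P assume pG: "\<forall>n. p n \<in> completed_graph x T" and lim: "p \<longlonglongrightarrow> P"
    obtain z t where P: "P = (z, t)" by force
    have z: "(\<lambda>n. fst (p n)) \<longlonglongrightarrow> z" and t: "(\<lambda>n. snd (p n)) \<longlonglongrightarrow> t"
      using tendsto_fst[OF lim] tendsto_snd[OF lim] P by auto
    have p: "0 \<le> snd (p n)" "snd (p n) \<le> T" "fst (p n) \<in> fibre x (snd (p n))" for n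
      using pG completed_graph_iff[OF assms(2)] by auto
    have t0: "0 \<le> t" "t \<le> T"
      by (rule LIMSEQ_le_const[OF t], use p in blast) (rule LIMSEQ_le_const2[OF t], use p in blast)
    have "z \<in> fibre x t"
    proof (rule ccontr)
      assume "z \<notin> fibre x t"
      then obtain e where "0 < e" "ball z e \<subseteq> - fibre x t"
        using closed_fibre[of x t] unfolding closed_def open_contains_ball by blast
      then have e: "0 < e" "ball z e \<inter> fibre x t = {}" by auto
      obtain h1 where h1: "0 < h1"
        "\<And>z s. z \<in> fibre x s \<Longrightarrow> 0 \<le> s \<Longrightarrow> t - h1 < s \<Longrightarrow> s < t \<Longrightarrow> 0 < t \<Longrightarrow> \<bar>z - left_lim x t\<bar> \<le> e/2"
      proof (cases "0 < t")
        case True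
        then show ?thesis using graph_near_left[OF assms(1) True, of "e/2"] e that by (metis half_gt_zero)
      next
        case False
        then show ?thesis using that[of 1] by auto
      qed
      obtain h2 where h2: "0 < h2"
        "\<And>z s. z \<in> fibre x s \<Longrightarrow> t < s \<Longrightarrow> s < t + h2 \<Longrightarrow> \<bar>z - x t\<bar> \<le> e/2"
        using graph_near_right[OF assms(1) t0(1), of "e/2"] e by (metis half_gt_zero)
      have "\<forall>\<^sub>F n in sequentially. \<bar>fst (p n) - z\<bar> < e/2 \<and> \<bar>snd (p n) - t\<bar> < min h1 h2"
        using tendstoD[OF z, of "e/2"] tendstoD[OF t, of "min h1 h2"] e h1 h2
        by (auto simp: dist_real_def eventually_conj_iff)
      then obtain n where n: "\<bar>fst (p n) - z\<bar> < e/2" "\<bar>snd (p n) - t\<bar> < min h1 h2"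
        using eventually_happens'[OF sequentially_bot] by blast
      have "\<exists>w\<in>fibre x t. \<bar>fst (p n) - w\<bar> \<le> e/2"
      proof (cases "snd (p n)" t rule: linorder_cases)
        case less
        then have "0 < t" using p(1)[of n] by linarith
        moreover have "\<bar>fst (p n) - left_lim x t\<bar> \<le> e/2"
          by (rule h1(2)[OF p(3,1)]) (use less n \<open>0 < t\<close> in auto)
        ultimately show ?thesis using fibre_ends by blast
      next
        case equal
        then show ?thesis using p(3)[of n] e(1) by (intro bexI[of _ "fst (p n)"]) auto
      next
        case greater
        have "\<bar>fst (p n) - x t\<bar> \<le> e/2"
          by (rule h2(2)[OF p(3)]) (use greater n in auto)
        then show ?thesis using fibre_ends by blast
      qed
      then obtain w where w: "w \<in> fibre x t" "\<bar>fst (p n) - w\<bar> \<le> e/2" by blast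
      then have "\<bar>z - w\<bar> < e" using n(1) by linarith
      then have "w \<in> ball z e" by (simp add: dist_real_def)
      with e(2) w(1) show False by auto
    qed
    then show "P \<in> completed_graph x T"
      using completed_graph_iff[OF assms(2)] P t0 by simp
  qed
qed

lemma graph_le_iff:
  "graph_le x P Q \<longleftrightarrow> snd P < snd Q \<or>
     (snd P = snd Q \<and> \<bar>left_lim x (snd P) - fst P\<bar> \<le> \<bar>left_lim x (snd P) - fst Q\<bar>)"
  unfolding graph_le_def by (cases P; cases Q) simp

lemma graph_le_total: "graph_le x P Q \<or> graph_le x Q P"
  unfolding graph_le_iff by auto

lemma fibre_eqI:
  assumes "z \<in> fibre x t" "w \<in> fibre x t" "\<bar>left_lim x t - z\<bar> = \<bar>left_lim x t - w\<bar>"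
  shows "z = w"
  using assms unfolding fibre_def by (auto simp: closed_segment_eq_real_ivl split: if_splits)

text \<open>
  The fraction of the jump at \<open>\<tau>\<close> that lies below a given point in the order of the
  completed graph. These functions separate points over the same time, they supply the height function
  below, and they drive the time change that matches the graph with the smoothed path.
\<close>

definition jump_frac :: "(real \<Rightarrow> real) \<Rightarrow> real \<Rightarrow> real \<times> real \<Rightarrow> real" where
  "jump_frac x \<tau> P = (if snd P < \<tau> then 0 else if \<tau> < snd P then 1
     else \<bar>left_lim x \<tau> - fst P\<bar> / \<bar>jump x \<tau>\<bar>)"

lemma jump_frac_range:
  assumes "P \<in> completed_graph x T" "0 \<le> T" "0 < \<tau>"
  shows "jump_frac x \<tau> P \<in> {0..1}"
proof -
  have "fst P \<in> fibre x (snd P)" using assms completed_graph_iff by blast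
  then have "snd P = \<tau> \<Longrightarrow> \<bar>left_lim x \<tau> - fst P\<bar> \<le> \<bar>jump x \<tau>\<bar>"
    using fibre_dist_le_jump[of "fst P" x "snd P"] assms by (auto simp: abs_minus_commute)
  then show ?thesis unfolding jump_frac_def by (auto simp: divide_le_eq_1)
qed

lemma jump_frac_mono:
  assumes "P \<in> completed_graph x T" "Q \<in> completed_graph x T" "0 \<le> T" "0 < \<tau>" "graph_le x P Q"
  shows "jump_frac x \<tau> P \<le> jump_frac x \<tau> Q"
proof -
  have r: "0 \<le> jump_frac x \<tau> P" "jump_frac x \<tau> P \<le> 1" "0 \<le> jump_frac x \<tau> Q" "jump_frac x \<tau> Q \<le> 1"
    using jump_frac_range[OF assms(1,3,4)] jump_frac_range[OF assms(2,3,4)] by auto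
  show ?thesis
  proof (cases "snd P = snd Q \<and> snd P = \<tau>")
    case True
    then show ?thesis using assms(5) by (auto simp: jump_frac_def graph_le_iff intro!: divide_right_mono)
  next
    case False
    show ?thesis
    proof (cases "snd P < \<tau>")
      case True then show ?thesis using r by (simp add: jump_frac_def)
    next
      case F2: False
      then have "\<tau> < snd Q \<or> snd P = snd Q" using False assms(5) by (auto simp: graph_le_iff)
      then show ?thesis
        using r F2 False by (auto simp: jump_frac_def)
    qed
  qed
qed

text \<open>
  Over \<open>\<tau>\<close> the function is a multiple of the distance to the left limit; fibres just before \<open>\<tau>\<close>
  are close to the left limit, where this multiple is \<open>0\<close>, and those just after are close to the
  value, where it is \<open>1\<close>.
\<close>

lemma continuous_on_jump_frac:
  assumes "cadlag x" "0 \<le> T" "0 < \<tau>" "jump x \<tau> \<noteq> 0 \<or> T < \<tau>"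
  shows "continuous_on (completed_graph x T) (jump_frac x \<tau>)"
  unfolding continuous_on_iff
proof (intro ballI allI impI)
  fix P and e :: real assume PG: "P \<in> completed_graph x T" and e: "0 < e"
  note inG = completed_graph_iff[OF assms(2)]
  have dsnd: "\<bar>snd Q - snd P\<bar> \<le> dist Q P" for Q
    using dist_snd_le[of Q P] by (simp add: dist_real_def)
  have dfst: "\<bar>fst Q - fst P\<bar> \<le> dist Q P" for Q
    using dist_fst_le[of Q P] by (simp add: dist_real_def)
  show "\<exists>d>0. \<forall>Q\<in>completed_graph x T. dist Q P < d \<longrightarrow> dist (jump_frac x \<tau> Q) (jump_frac x \<tau> P) < e"
  proof (cases "snd P" \<tau> rule: linorder_cases)
    case less
    show ?thesis
    proof (rule exI[of _ "\<tau> - snd P"], intro conjI ballI impI)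
      fix Q assume "dist Q P < \<tau> - snd P"
      then have "snd Q < \<tau>" using dsnd[of Q] by linarith
      then show "dist (jump_frac x \<tau> Q) (jump_frac x \<tau> P) < e" using less e by (simp add: jump_frac_def)
    qed (use less in simp)
  next
    case greater
    show ?thesis
    proof (rule exI[of _ "snd P - \<tau>"], intro conjI ballI impI)
      fix Q assume "dist Q P < snd P - \<tau>"
      then have "\<tau> < snd Q" using dsnd[of Q] by linarith
      then show "dist (jump_frac x \<tau> Q) (jump_frac x \<tau> P) < e" using greater e by (simp add: jump_frac_def)
    qed (use greater in simp)
  next
    case equal
    define a where "a = left_lim x \<tau>"
    define j where "j = \<bar>jump x \<tau>\<bar>"
    have j: "0 < j" using assms(4) inG[of P] PG equal unfolding j_def by auto
    have ej: "0 < e * j / 2" using e j by simp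
    obtain h1 where h1: "0 < h1"
      "\<And>z s. z \<in> fibre x s \<Longrightarrow> 0 \<le> s \<Longrightarrow> \<tau> - h1 < s \<Longrightarrow> s < \<tau> \<Longrightarrow> \<bar>z - a\<bar> \<le> e * j / 2"
      using graph_near_left[OF assms(1,3) ej] unfolding a_def by metis
    obtain h2 where h2: "0 < h2"
      "\<And>z s. z \<in> fibre x s \<Longrightarrow> \<tau> < s \<Longrightarrow> s < \<tau> + h2 \<Longrightarrow> \<bar>z - x \<tau>\<bar> \<le> e * j / 2"
      using graph_near_right[OF assms(1) _ ej] assms(3) by (metis less_imp_le)
    have fP: "jump_frac x \<tau> P = \<bar>a - fst P\<bar> / j"
      using equal by (simp add: jump_frac_def a_def j_def)
    show ?thesis
    proof (rule exI[of _ "min (e * j / 2) (min h1 h2)"], intro conjI ballI impI)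
      show "0 < min (e * j / 2) (min h1 h2)" using ej h1 h2 by simp
      fix Q assume QG: "Q \<in> completed_graph x T" and d: "dist Q P < min (e * j / 2) (min h1 h2)"
      have Q: "0 \<le> snd Q" "fst Q \<in> fibre x (snd Q)" using inG[of Q] QG by auto
      have dz: "\<bar>fst Q - fst P\<bar> < e * j / 2" using dfst[of Q] d by linarith
      have dt: "\<bar>snd Q - \<tau>\<bar> < min h1 h2" using dsnd[of Q] d equal by linarith
      have "\<bar>jump_frac x \<tau> Q * j - \<bar>a - fst P\<bar>\<bar> < e * j"
      proof (cases "snd Q" \<tau> rule: linorder_cases)
        case less
        have "\<bar>fst Q - a\<bar> \<le> e * j / 2" by (rule h1(2)[OF Q(2,1)]) (use less dt in auto)
        then have "\<bar>a - fst P\<bar> < e * j" using dz by linarith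
        then show ?thesis using less by (simp add: jump_frac_def)
      next
        case equal
        then have "jump_frac x \<tau> Q * j = \<bar>a - fst Q\<bar>" using j by (simp add: jump_frac_def a_def j_def)
        then show ?thesis using dz ej by linarith
      next
        case greater
        have "\<bar>fst Q - x \<tau>\<bar> \<le> e * j / 2" by (rule h2(2)[OF Q(2)]) (use greater dt in auto)
        moreover have "jump_frac x \<tau> Q * j = \<bar>x \<tau> - a\<bar>" using greater by (simp add: jump_frac_def a_def j_def)
        ultimately show ?thesis using dz ej by linarith
      qed
      moreover have "jump_frac x \<tau> Q * j - \<bar>a - fst P\<bar> = (jump_frac x \<tau> Q - jump_frac x \<tau> P) * j"
        using j fP by (simp add: algebra_simps)
      ultimately have "\<bar>jump_frac x \<tau> Q - jump_frac x \<tau> P\<bar> * j < e * j"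
        using j by (simp add: abs_mult)
      then show "dist (jump_frac x \<tau> Q) (jump_frac x \<tau> P) < e"
        using j by (simp add: dist_real_def)
    qed
  qed
qed

section \<open>Parametric representations\<close>

text \<open>
  The height is time plus the sum of the jump fractions over all jump times, weighted by
  \<open>2\<^sup>-\<^sup>n\<close> along an enumeration. Time separates points of different fibres and the jump
  fractions those of the same fibre. The weights make the series converge uniformly, whereas the
  jump sizes need not be summable.
\<close>

lemma graph_height:
  assumes "cadlag x" "0 < T"
  shows "\<exists>l :: real \<times> real \<Rightarrow> real. continuous_on (completed_graph x T) l \<and>
    (\<forall>P\<in>completed_graph x T. \<forall>Q\<in>completed_graph x T. graph_le x P Q \<longrightarrow> P \<noteq> Q \<longrightarrow> l P < l Q)"
proof -
  have T0: "0 \<le> T" using assms by simp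
  note inG = completed_graph_iff[OF T0]
  define J where "J = {t \<in> {0<..T}. jump x t \<noteq> 0}"
  \<comment> \<open>the extra time \<open>T + 1\<close>, whose fraction vanishes on the graph, keeps the enumerated set nonempty\<close>
  define \<tau> where "\<tau> = from_nat_into (insert (T + 1) J)"
  have ran: "range \<tau> = insert (T + 1) J"
    using cadlag_countable_jumps[OF assms(1), of T] unfolding \<tau>_def J_def[symmetric]
    by (intro range_from_nat_into) auto
  have \<tau>: "0 < \<tau> n" "jump x (\<tau> n) \<noteq> 0 \<or> T < \<tau> n" for n
    using rangeI[of \<tau> n] assms(2) unfolding ran J_def by auto
  define f where "f n P = (1/2) ^ n * jump_frac x (\<tau> n) P" for n :: nat and P
  define l where "l P = snd P + (\<Sum>n. f n P)" for P
  have f01: "0 \<le> f n P" "f n P \<le> (1/2) ^ n" if "P \<in> completed_graph x T" for n P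
    using jump_frac_range[OF that T0 \<tau>(1)[of n]] unfolding f_def
    by (auto intro!: mult_nonneg_nonneg mult_left_le)
  have geo: "summable (\<lambda>n. (1/2::real) ^ n)" by (intro summable_geometric) simp
  have summ: "summable (\<lambda>n. f n P)" if "P \<in> completed_graph x T" for P
    by (rule summable_comparison_test'[OF geo]) (use f01[OF that] in auto)
  have fmono: "f n P \<le> f n Q"
    if "P \<in> completed_graph x T" "Q \<in> completed_graph x T" "graph_le x P Q" for n P Q
    unfolding f_def using jump_frac_mono[OF that(1,2) T0 \<tau>(1) that(3)]
    by (intro mult_left_mono) auto
  show ?thesis
  proof (intro exI[of _ l] conjI ballI impI)
    have "continuous_on (completed_graph x T) (\<lambda>P. \<Sum>n. f n P)"
    proof (rule uniform_limit_theorem)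
      show "uniform_limit (completed_graph x T) (\<lambda>n P. \<Sum>i<n. f i P) (\<lambda>P. \<Sum>i. f i P) sequentially"
        by (rule Weierstrass_m_test[OF _ geo]) (use f01 in auto)
      show "\<forall>\<^sub>F n in sequentially. continuous_on (completed_graph x T) (\<lambda>P. \<Sum>i<n. f i P)"
        unfolding f_def using continuous_on_jump_frac[OF assms(1) T0 \<tau>]
        by (intro always_eventually allI continuous_intros)
    qed simp
    then show "continuous_on (completed_graph x T) l"
      unfolding l_def by (intro continuous_intros)
    fix P Q assume PQ: "P \<in> completed_graph x T" "Q \<in> completed_graph x T" "graph_le x P Q" "P \<noteq> Q"
    have le: "(\<Sum>n. f n P) \<le> (\<Sum>n. f n Q)"
      by (intro suminf_le summ PQ fmono)
    show "l P < l Q"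
    proof (cases "snd P < snd Q")
      case True then show ?thesis using le by (simp add: l_def)
    next
      case False
      define t where "t = snd P"
      have t: "snd Q = t" and d: "\<bar>left_lim x t - fst P\<bar> \<le> \<bar>left_lim x t - fst Q\<bar>"
        using False PQ(3) by (auto simp: graph_le_iff t_def)
      have fib: "fst P \<in> fibre x t" "fst Q \<in> fibre x t" "0 \<le> t" "t \<le> T"
        using inG[of P] inG[of Q] PQ t by (auto simp: t_def)
      have ne: "fst P \<noteq> fst Q" using PQ(4) t by (auto simp: t_def prod_eq_iff)
      then have d': "\<bar>left_lim x t - fst P\<bar> < \<bar>left_lim x t - fst Q\<bar>"
        using fibre_eqI[OF fib(1,2)] d by force
      have "t \<noteq> 0" using fib ne by (auto simp: fibre_def)
      moreover have "jump x t \<noteq> 0" using fib ne \<open>t \<noteq> 0\<close> by (auto simp: fibre_def)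
      ultimately have "t \<in> range \<tau>" using fib unfolding ran J_def by auto
      then obtain m where m: "\<tau> m = t" by auto
      have "jump_frac x t P < jump_frac x t Q"
        using d' t \<open>jump x t \<noteq> 0\<close> by (simp add: jump_frac_def t_def divide_strict_right_mono)
      then have "f m P < f m Q" unfolding f_def m by simp
      then have "0 < f m Q - f m P" by simp
      then have "0 < (\<Sum>n. f n Q - f n P)"
        by (intro suminf_pos2[of _ m] summable_diff summ PQ) (use fmono[OF PQ(1-3)] in auto)
      also have "\<dots> = (\<Sum>n. f n Q) - (\<Sum>n. f n P)"
        by (rule suminf_diff[symmetric]) (intro summ PQ)+
      finally show ?thesis using t by (simp add: l_def t_def)
    qed
  qed
qed

lemma graph_ends:
  assumes "0 \<le> T"
  shows "(x 0, 0) \<in> completed_graph x T" "(x T, T) \<in> completed_graph x T"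
    and "P \<in> completed_graph x T \<Longrightarrow> graph_le x (x 0, 0) P"
    and "P \<in> completed_graph x T \<Longrightarrow> graph_le x P (x T, T)"
proof -
  note inG = completed_graph_iff[OF assms]
  show "(x 0, 0) \<in> completed_graph x T" "(x T, T) \<in> completed_graph x T"
    using assms fibre_ends[where x = x] by (auto simp: inG)
  assume "P \<in> completed_graph x T"
  then have P: "0 \<le> snd P" "snd P \<le> T" "fst P \<in> fibre x (snd P)" using inG by auto
  show "graph_le x (x 0, 0) P"
    using P by (cases "snd P = 0") (auto simp: graph_le_iff fibre_def)
  show "graph_le x P (x T, T)"
  proof (cases "snd P = T")
    case True
    show ?thesis
    proof (cases "T = 0")
      case False
      then show ?thesis
        using True fibre_dist_le_jump[OF P(3)] by (simp add: graph_le_iff abs_minus_commute)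
    qed (use True P in \<open>auto simp: graph_le_iff fibre_def\<close>)
  qed (use P in \<open>auto simp: graph_le_iff\<close>)
qed

text \<open>
  The completed graph has no gaps. For an intermediate value \<open>u\<close>, take the last time \<open>t\<close> at
  which the height of the path is at most \<open>u\<close>: right continuity puts \<open>u\<close> below the height of
  \<open>(x t, t)\<close>, the left limit puts it above the height of the other end of the fibre, and the
  intermediate value theorem on the fibre does the rest.
\<close>

lemma graph_height_image:
  fixes l :: "real \<times> real \<Rightarrow> real"
  assumes x: "cadlag x" and T: "0 < T" and cont: "continuous_on (completed_graph x T) l"
    and mono: "\<And>P Q. P \<in> completed_graph x T \<Longrightarrow> Q \<in> completed_graph x T \<Longrightarrow> graph_le x P Q \<Longrightarrow> l P \<le> l Q"
  shows "l ` completed_graph x T = {l (x 0, 0)..l (x T, T)}"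
proof
  let ?G = "completed_graph x T"
  have T0: "0 \<le> T" using T by simp
  note inG = completed_graph_iff[OF T0]
  note ends = graph_ends[OF T0]
  show "l ` ?G \<subseteq> {l (x 0, 0)..l (x T, T)}"
    using mono ends by auto
  show "{l (x 0, 0)..l (x T, T)} \<subseteq> l ` ?G"
  proof
    fix u assume "u \<in> {l (x 0, 0)..l (x T, T)}"
    then have u: "l (x 0, 0) \<le> u" "u \<le> l (x T, T)" by auto
    have xG: "(x s, s) \<in> ?G" if "0 \<le> s" "s \<le> T" for s
      using that fibre_ends by (simp add: inG)
    define A where "A = {s \<in> {0..T}. l (x s, s) \<le> u}"
    have A0: "0 \<in> A" using u T by (simp add: A_def)
    have bdd: "bdd_above A" by (rule bdd_aboveI[of _ T]) (simp add: A_def)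
    define t where "t = Sup A"
    have t: "0 \<le> t" "t \<le> T"
      unfolding t_def by (rule cSup_upper[OF A0 bdd], rule cSup_least, use A0 in blast, simp add: A_def)
    have tG: "(x t, t) \<in> ?G" using xG t by blast
    have above: "u < l (x s, s)" if "t < s" "s \<le> T" for s
    proof (rule ccontr)
      assume "\<not> ?thesis"
      then have "s \<in> A" using that t by (simp add: A_def)
      then show False using cSup_upper[OF _ bdd, of s] that by (simp add: t_def)
    qed
    have below: "l (x s, s) \<le> u" if s: "0 \<le> s" "s < t" for s
    proof -
      obtain a where a: "a \<in> A" "s < a"
        using less_cSupD[of A s] s(2) A0 unfolding t_def by blast
      then have "l (x s, s) \<le> l (x a, a)"
        using s t by (intro mono xG) (auto simp: A_def graph_le_iff)
      also have "\<dots> \<le> u" using a by (simp add: A_def)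
      finally show ?thesis .
    qed
    have ge: "u \<le> l (x t, t)"
    proof (cases "t = T")
      case False
      then have tT: "t < T" using t by simp
      show ?thesis
      proof (rule tendsto_lowerbound)
        have "(x \<longlongrightarrow> x t) (at_right t)" using x t unfolding cadlag_def by blast
        then have "((\<lambda>s. (x s, s)) \<longlongrightarrow> (x t, t)) (at_right t)" by (intro tendsto_intros)
        moreover have "\<forall>\<^sub>F s in at_right t. (x s, s) \<in> ?G"
          unfolding eventually_at_right_field using tT t xG by (intro exI[of _ T]) auto
        ultimately show "((\<lambda>s. l (x s, s)) \<longlongrightarrow> l (x t, t)) (at_right t)"
          by (rule continuous_on_tendsto_compose[OF cont _ tG])
        show "\<forall>\<^sub>F s in at_right t. u \<le> l (x s, s)"
          unfolding eventually_at_right_field using tT above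
          by (intro exI[of _ T]) (auto intro: less_imp_le)
      qed simp
    qed (use u in simp)
    show "u \<in> l ` ?G"
    proof (cases "t = 0")
      case True
      then have "l (x t, t) = u" using ge u by auto
      then show ?thesis using tG by auto
    next
      case False
      then have t0: "0 < t" using t by simp
      let ?a = "left_lim x t"
      have sG: "(z, t) \<in> ?G" if "z \<in> closed_segment ?a (x t)" for z
        using that False t by (simp add: inG fibre_def)
      have le: "l (?a, t) \<le> u"
      proof (rule tendsto_upperbound)
        have "(x \<longlongrightarrow> ?a) (at_left t)" by (rule cadlag_left_lim[OF x t0])
        then have "((\<lambda>s. (x s, s)) \<longlongrightarrow> (?a, t)) (at_left t)" by (intro tendsto_intros)
        moreover have "\<forall>\<^sub>F s in at_left t. (x s, s) \<in> ?G"
          unfolding eventually_at_left_field using t0 t xG by (intro exI[of _ 0]) auto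
        ultimately show "((\<lambda>s. l (x s, s)) \<longlongrightarrow> l (?a, t)) (at_left t)"
          using sG[of ?a] by (intro continuous_on_tendsto_compose[OF cont]) auto
        show "\<forall>\<^sub>F s in at_left t. l (x s, s) \<le> u"
          unfolding eventually_at_left_field using t0 below by (intro exI[of _ 0]) auto
      qed simp
      have "continuous_on (closed_segment ?a (x t)) (\<lambda>z. l (z, t))"
        by (rule continuous_on_compose2[OF cont]) (use sG in \<open>auto intro!: continuous_intros\<close>)
      then have "connected ((\<lambda>z. l (z, t)) ` closed_segment ?a (x t))"
        by (rule connected_continuous_image) simp
      then have "u \<in> (\<lambda>z. l (z, t)) ` closed_segment ?a (x t)"
        by (rule connectedD_interval[OF _ _ _ le ge]) auto
      then show ?thesis using sG by auto
    qed
  qed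
qed

text \<open>
  A continuous bijection from a compact set onto an interval has a continuous inverse,
  and the inverse of the height function runs through the graph in its order.
\<close>

lemma parametric_rep_exists:
  assumes "cadlag x" "0 < T"
  obtains p where "p \<in> parametric_reps x T"
proof -
  let ?G = "completed_graph x T"
  have T0: "0 \<le> T" using assms by simp
  obtain l :: "real \<times> real \<Rightarrow> real" where cont: "continuous_on ?G l"
    and strict: "\<And>P Q. P \<in> ?G \<Longrightarrow> Q \<in> ?G \<Longrightarrow> graph_le x P Q \<Longrightarrow> P \<noteq> Q \<Longrightarrow> l P < l Q"
    using graph_height[OF assms] by blast
  define a where "a = l (x 0, 0)"
  define b where "b = l (x T, T)"
  have mono: "l P \<le> l Q" if "P \<in> ?G" "Q \<in> ?G" "graph_le x P Q" for P Q
    using strict[OF that] by (cases "P = Q") auto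
  have img: "l ` ?G = {a..b}"
    unfolding a_def b_def by (rule graph_height_image[OF assms cont mono])
  have "(x 0, 0) \<noteq> (x T, T)" using assms(2) by simp
  then have ab: "a < b"
    unfolding a_def b_def using strict graph_ends[OF T0, where x = x] by metis
  have inj: "inj_on l ?G"
  proof (rule inj_onI, rule ccontr)
    fix P Q assume "P \<in> ?G" "Q \<in> ?G" "l P = l Q" "P \<noteq> Q"
    then show False using strict[of P Q] strict[of Q P] graph_le_total[of x P Q] by auto
  qed
  define g where "g = the_inv_into ?G l"
  have gl: "g (l P) = P" if "P \<in> ?G" for P
    unfolding g_def by (rule the_inv_into_f_f[OF inj that])
  have gG: "g v \<in> ?G" "l (g v) = v" if "v \<in> {a..b}" for v
    using that gl unfolding img[symmetric] by auto
  have contg: "continuous_on {a..b} g"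
    unfolding img[symmetric]
    by (rule continuous_on_inv[OF cont compact_completed_graph[OF assms(1) T0]]) (use gl in auto)
  define h where "h u = a + u * (b - a)" for u
  have h: "h ` {0..1} = {a..b}"
  proof
    show "h ` {0..1} \<subseteq> {a..b}"
    proof (rule image_subsetI)
      fix u :: real assume "u \<in> {0..1}"
      then have "0 \<le> u * (b - a)" "u * (b - a) \<le> 1 * (b - a)"
        using ab by (auto intro!: mult_nonneg_nonneg mult_right_mono)
      then show "h u \<in> {a..b}" by (auto simp: h_def)
    qed
    show "{a..b} \<subseteq> h ` {0..1}"
    proof
      fix v assume "v \<in> {a..b}"
      then show "v \<in> h ` {0..1}"
        using ab by (intro image_eqI[of _ _ "(v - a) / (b - a)"]) (auto simp: h_def divide_le_eq_1)
    qed
  qed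
  show ?thesis
  proof (rule that[of "g \<circ> h"], unfold parametric_reps_def, intro CollectI conjI ballI impI)
    show "continuous_on {0..1} (g \<circ> h)"
      unfolding h_def by (intro continuous_on_compose continuous_intros)
        (use contg h in \<open>simp add: h_def[abs_def]\<close>)
    show "(g \<circ> h) ` {0..1} = ?G"
      unfolding image_comp[symmetric] h img[symmetric] image_image using gl by simp
    fix u v :: real assume uv: "u \<in> {0..1}" "v \<in> {0..1}" "u \<le> v"
    then have huv: "h u \<in> {a..b}" "h v \<in> {a..b}" using h by blast+
    have hle: "h u \<le> h v" unfolding h_def using uv ab by (simp add: mult_right_mono)
    show "graph_le x ((g \<circ> h) u) ((g \<circ> h) v)"
    proof (rule ccontr)
      assume "\<not> ?thesis"
      then have n: "\<not> graph_le x (g (h u)) (g (h v))" by simp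
      then have "graph_le x (g (h v)) (g (h u))"
        using graph_le_total[of x "g (h u)" "g (h v)"] by blast
      moreover have "g (h v) \<noteq> g (h u)"
        using n graph_le_total[of x "g (h v)" "g (h v)"] by metis
      ultimately have "l (g (h v)) < l (g (h u))" using strict gG(1) huv by blast
      then show False using gG(2) huv hle by simp
    qed
  qed
qed

section \<open>Bounding the distance to a continuous path by a time change of the graph\<close>

lemma completed_graph_continuous:
  assumes "continuous_on {0..T} y" "0 \<le> T"
  shows "completed_graph y T = (\<lambda>s. (y s, s)) ` {0..T}"
proof -
  have lim: "left_lim y s = y s" if s: "0 < s" "s \<le> T" for s
  proof (rule tendsto_Lim)
    have "(y \<longlongrightarrow> y s) (at s within {0..s})"
      using continuous_on_subset[OF assms(1), of "{0..s}"] s by (auto simp: continuous_on_def)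
    then show "(y \<longlongrightarrow> y s) (at_left s)"
      using s by (simp add: at_within_Icc_at_left)
  qed simp
  have "fibre y s = {y s}" if "0 \<le> s" "s \<le> T" for s
    using lim[of s] that by (auto simp: fibre_def)
  then show "completed_graph y T = (\<lambda>s. (y s, s)) ` {0..T}"
    using completed_graph_iff[OF assms(2), of _ y] by (force simp: prod_eq_iff)
qed

text \<open>
  A parametric representation \<open>p\<close> of \<open>x\<close> and a time change \<open>\<sigma>\<close> on the completed graph give the
  representation \<open>u \<mapsto> (y (\<sigma> (p u)), \<sigma> (p u))\<close> of the continuous path \<open>y\<close>. The bound can then
  be checked on the points of the graph, whatever \<open>p\<close> is.
\<close>

lemma m1_dist_upto_le:
  assumes x: "cadlag x" and T: "0 < T" and y: "continuous_on {0..T} y"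
    and \<sigma>: "continuous_on (completed_graph x T) \<sigma>"
    and mono: "\<And>P Q. P \<in> completed_graph x T \<Longrightarrow> Q \<in> completed_graph x T \<Longrightarrow> graph_le x P Q \<Longrightarrow> \<sigma> P \<le> \<sigma> Q"
    and ends: "\<sigma> (x 0, 0) = 0" "\<sigma> (x T, T) = T"
    and close: "\<And>P. P \<in> completed_graph x T \<Longrightarrow> \<bar>y (\<sigma> P) - fst P\<bar> \<le> e"
      "\<And>P. P \<in> completed_graph x T \<Longrightarrow> \<bar>\<sigma> P - snd P\<bar> \<le> e"
  shows "m1_dist_upto T y x \<le> e"
proof -
  let ?G = "completed_graph x T"
  have T0: "0 \<le> T" using T by simp
  obtain p where pR: "p \<in> parametric_reps x T" using parametric_rep_exists[OF x T] .
  then have pc: "continuous_on {0..1} p" and pG: "p ` {0..1} = ?G"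
    and pm: "\<And>u v. u \<in> {0..1} \<Longrightarrow> v \<in> {0..1} \<Longrightarrow> u \<le> v \<Longrightarrow> graph_le x (p u) (p v)"
    unfolding parametric_reps_def by auto
  have \<sigma>G: "\<sigma> ` ?G = {0..T}"
    using graph_height_image[OF x T \<sigma> mono] ends by simp
  define s where "s u = \<sigma> (p u)" for u
  have sc: "continuous_on {0..1} s"
    unfolding s_def by (rule continuous_on_compose2[OF \<sigma> pc]) (use pG in auto)
  have sG: "s ` {0..1} = {0..T}"
    using \<sigma>G pG unfolding s_def by (metis image_image)
  have sm: "s u \<le> s v" if "u \<in> {0..1}" "v \<in> {0..1}" "u \<le> v" for u v
    unfolding s_def using pm[OF that] pG that by (intro mono) auto
  define q where "q u = (y (s u), s u)" for u
  have qR: "q \<in> parametric_reps y T"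
    unfolding parametric_reps_def
  proof (intro CollectI conjI ballI impI)
    show "continuous_on {0..1} q"
      unfolding q_def using sG by (intro continuous_intros continuous_on_compose2[OF y sc] sc) auto
    show "q ` {0..1} = completed_graph y T"
      unfolding completed_graph_continuous[OF y T0] sG[symmetric] image_image q_def ..
    show "graph_le y (q u) (q v)" if "u \<in> {0..1}" "v \<in> {0..1}" "u \<le> v" for u v
      using sm[OF that] by (auto simp: graph_le_iff q_def)
  qed
  let ?d = "\<lambda>p q :: real \<Rightarrow> real \<times> real. SUP u\<in>{0..1}. max \<bar>fst (p u) - fst (q u)\<bar> \<bar>snd (p u) - snd (q u)\<bar>"
  have bdd: "bdd_below ((\<lambda>(p, q). ?d p q) ` (parametric_reps y T \<times> parametric_reps x T))"
  proof (rule bdd_belowI2[of _ 0], clarify)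
    fix p q assume "p \<in> parametric_reps y T" "q \<in> parametric_reps x T"
    then have c: "continuous_on {0..1} p" "continuous_on {0..1} q" unfolding parametric_reps_def by auto
    have "compact ((\<lambda>u. max \<bar>fst (p u) - fst (q u)\<bar> \<bar>snd (p u) - snd (q u)\<bar>) ` {0..1::real})"
      using c by (intro compact_continuous_image continuous_intros) auto
    then have bdd: "bdd_above ((\<lambda>u. max \<bar>fst (p u) - fst (q u)\<bar> \<bar>snd (p u) - snd (q u)\<bar>) ` {0..1::real})"
      by (intro bounded_imp_bdd_above compact_imp_bounded)
    have "0 \<le> max \<bar>fst (p 0) - fst (q 0)\<bar> \<bar>snd (p 0) - snd (q 0)\<bar>" by simp
    also have "\<dots> \<le> ?d p q" by (rule cSUP_upper[OF _ bdd]) simp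
    finally show "0 \<le> ?d p q" .
  qed
  have "m1_dist_upto T y x \<le> (case (q, p) of (p, q) \<Rightarrow> ?d p q)"
    unfolding m1_dist_upto_def by (rule cINF_lower[OF bdd]) (use pR qR in simp)
  also have "\<dots> = ?d q p" by simp
  also have "\<dots> \<le> e"
  proof (rule cSUP_least)
    fix u :: real assume "u \<in> {0..1}"
    then have "p u \<in> ?G" using pG by blast
    then show "max \<bar>fst (q u) - fst (p u)\<bar> \<bar>snd (q u) - snd (p u)\<bar> \<le> e"
      using close[of "p u"] by (simp add: q_def s_def)
  qed simp
  finally show ?thesis .
qed

section \<open>Exponential smoothing of a path\<close>

text \<open>
  The integral form of \<open>y' = lam (x - y)\<close>, \<open>y 0 = 0\<close>, which makes sense although \<open>x\<close> jumps.
\<close>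

locale smoothed_path =
  fixes x y :: "real \<Rightarrow> real" and lam :: real
  assumes cadlag: "cadlag x" and lam: "0 < lam" and start: "x 0 = 0"
    and integrable: "0 \<le> t \<Longrightarrow> (\<lambda>s. x s - y s) integrable_on {0..t}"
    and y_eq: "0 \<le> t \<Longrightarrow> y t = lam * integral {0..t} (\<lambda>s. x s - y s)"
begin

lemma y_start: "y 0 = 0"
  using y_eq[of 0] by simp

lemma y_continuous: "continuous_on {0..t} y"
proof (cases "0 \<le> t")
  case True
  have "continuous_on {0..t} (\<lambda>s. lam * integral {0..s} (\<lambda>s. x s - y s))"
    by (intro continuous_intros indefinite_integral_continuous_1 integrable True)
  then show ?thesis by (rule continuous_on_eq) (use y_eq in auto)
qed simp

lemma y_increment:
  assumes "0 \<le> r" "r \<le> t"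
  shows "y t - y r = lam * integral {r..t} (\<lambda>s. x s - y s)"
    and "(\<lambda>s. x s - y s) integrable_on {r..t}"
proof -
  have "integral {0..r} (\<lambda>s. x s - y s) + integral {r..t} (\<lambda>s. x s - y s) = integral {0..t} (\<lambda>s. x s - y s)"
    by (rule Henstock_Kurzweil_Integration.integral_combine) (use assms integrable in auto)
  then show "y t - y r = lam * integral {r..t} (\<lambda>s. x s - y s)"
    using y_eq[of r] y_eq[of t] assms by (simp add: algebra_simps flip: distrib_left)
  show "(\<lambda>s. x s - y s) integrable_on {r..t}"
    by (rule integrable_on_subinterval[OF integrable[of t]]) (use assms in auto)
qed

text \<open>
  A comparison principle: the excess \<open>w\<close> of \<open>y\<close> over the solution for the constant input \<open>m\<close>
  cannot increase while it is positive, and it starts at \<open>0\<close>.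
\<close>

lemma relax_upper:
  assumes rt: "0 \<le> r" "r \<le> t" and le: "\<And>s. r \<le> s \<Longrightarrow> s < t \<Longrightarrow> x s \<le> m"
  shows "y t \<le> m + exp (- lam * (t - r)) * (y r - m)"
proof (rule ccontr)
  assume neg: "\<not> ?thesis"
  define E where "E s = exp (- lam * (s - r)) * (y r - m)" for s
  define w where "w s = y s - m - E s" for s
  have wt: "0 < w t" using neg by (simp add: w_def E_def)
  have wr: "w r = 0" by (simp add: w_def E_def)
  have wc: "continuous_on {r..t} w"
    unfolding w_def E_def
    by (intro continuous_intros continuous_on_subset[OF y_continuous[of t]]) (use rt in auto)
  \<comment> \<open>the last time before \<open>t\<close> at which \<open>w\<close> is not positive\<close>
  define S where "S = {s \<in> {r..t}. w s \<le> 0}"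
  have compS: "compact S"
  proof -
    have "closed S" unfolding S_def
      by (rule continuous_on_closed_Collect_le[OF wc continuous_on_const]) simp
    moreover have "bounded S"
      by (rule bounded_subset[OF bounded_closed_interval[of r t]]) (auto simp: S_def)
    ultimately show ?thesis by (simp add: compact_eq_bounded_closed)
  qed
  have "S \<noteq> {}" using wr rt by (auto simp: S_def)
  then obtain u where u: "u \<in> S" "\<And>s. s \<in> S \<Longrightarrow> s \<le> u"
    using compact_attains_sup[OF compS] by blast
  have ru: "r \<le> u" "u \<le> t" "w u \<le> 0" using u(1) by (auto simp: S_def)
  have pos: "0 < w s" if "u < s" "s \<le> t" for s
    using u(2)[of s] that ru by (cases "w s \<le> 0") (auto simp: S_def)
  have E': "((\<lambda>s. - lam * E s) has_integral (E t - E u)) {u..t}"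
    unfolding E_def
    by (rule fundamental_theorem_of_calculus[OF ru(2)])
      (auto intro!: derivative_eq_intros simp: has_real_derivative_iff_has_vector_derivative[symmetric])
  have inc: "y t - y u = lam * integral {u..t} (\<lambda>s. x s - y s)"
    and int: "(\<lambda>s. x s - y s) integrable_on {u..t}"
    using y_increment[of u t] ru rt by auto
  have "((\<lambda>s. lam * (x s - y s)) has_integral (y t - y u)) {u..t}"
    unfolding inc by (intro has_integral_mult_right integrable_integral int)
  from has_integral_diff[OF this E']
  have hi: "((\<lambda>s. lam * (x s - y s + E s)) has_integral (w t - w u)) {u..t}"
    by (simp add: w_def algebra_simps)
  \<comment> \<open>the bound on \<open>x\<close> may fail at \<open>t\<close>, and the sign of \<open>w\<close> at \<open>u\<close>, so the endpoints are removed from the integrand\<close>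
  have "w t - w u \<le> 0"
  proof (rule has_integral_le[OF _ has_integral_0, where f = "\<lambda>s. if s \<in> {u, t} then 0 else lam * (x s - y s + E s)"])
    show "((\<lambda>s. if s \<in> {u, t} then 0 else lam * (x s - y s + E s)) has_integral (w t - w u)) {u..t}"
      by (rule has_integral_spike_finite[OF _ _ hi, of "{u, t}"]) auto
    fix s assume s: "s \<in> {u..t}"
    show "(if s \<in> {u, t} then 0 else lam * (x s - y s + E s)) \<le> 0"
    proof (cases "s \<in> {u, t}")
      case False
      then have "u < s" "s < t" using s by auto
      then have "x s \<le> m" "0 < w s" using le[of s] pos[of s] ru by auto
      then have "x s - y s + E s \<le> 0" by (simp add: w_def)
      then show ?thesis using False lam by (simp add: mult_nonneg_nonpos)
    qed simp
  qed
  then show False using wt ru by linarith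
qed

text \<open>
  This symmetry turns the upper bound of \<open>relax_upper\<close> into the lower one.
\<close>

lemma smoothed_path_uminus: "smoothed_path (\<lambda>t. - x t) (\<lambda>t. - y t) lam"
proof
  show "cadlag (\<lambda>t. - x t)"
    using cadlag unfolding cadlag_def by (blast intro: tendsto_minus)
  fix t :: real assume t: "0 \<le> t"
  have eq: "(\<lambda>s. - x s - - y s) = (\<lambda>s. - (x s - y s))" by auto
  show "(\<lambda>s. - x s - - y s) integrable_on {0..t}"
    unfolding eq by (intro integrable_neg integrable t)
  show "- y t = lam * integral {0..t} (\<lambda>s. - x s - - y s)"
    unfolding eq integral_neg using y_eq[OF t] by simp
qed (use lam start in auto)

text \<open>
  The relaxation estimate: \<open>y\<close> forgets its value at time \<open>r\<close> at the exponential rate \<open>lam\<close>.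
\<close>

lemma relax:
  assumes rt: "0 \<le> r" "r \<le> t" and near: "\<And>s. r \<le> s \<Longrightarrow> s < t \<Longrightarrow> \<bar>x s - b\<bar> \<le> e" and e: "0 \<le> e"
  shows "\<bar>y t - b - exp (- lam * (t - r)) * (y r - b)\<bar> \<le> e"
proof -
  interpret neg: smoothed_path "\<lambda>t. - x t" "\<lambda>t. - y t" lam by (rule smoothed_path_uminus)
  define k where "k = exp (- lam * (t - r))"
  have "y t \<le> b + e + k * (y r - (b + e))"
    unfolding k_def by (rule relax_upper[OF rt]) (use near in \<open>force simp: abs_le_iff\<close>)
  moreover have "- y t \<le> e - b + k * (- y r - (e - b))"
    unfolding k_def by (rule neg.relax_upper[OF rt]) (use near in \<open>force simp: abs_le_iff\<close>)
  moreover have "0 \<le> k * e" using e by (simp add: k_def)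
  ultimately show ?thesis
    unfolding k_def[symmetric] by (simp add: abs_le_iff algebra_simps)
qed

lemma y_bounded:
  assumes "\<And>s. 0 \<le> s \<Longrightarrow> s < K \<Longrightarrow> \<bar>x s\<bar> \<le> B" "0 \<le> t" "t < K"
  shows "\<bar>y t\<bar> \<le> B"
  using relax[of 0 t 0 B] assms y_start by (force intro: order_trans[OF abs_ge_zero])

end

section \<open>Following the completed graph with the smoothed path\<close>

lemma continuous_on_Max_insert:
  fixes f :: "'b::topological_space \<Rightarrow> real"
  assumes "finite J" "continuous_on A f" "\<And>j. j \<in> J \<Longrightarrow> continuous_on A (g j)"
  shows "continuous_on A (\<lambda>P. Max (insert (f P) ((\<lambda>j. g j P) ` J)))"
  using assms
proof (induction J)
  case (insert j J)
  have "Max (insert (f P) ((\<lambda>j. g j P) ` insert j J)) = max (g j P) (Max (insert (f P) ((\<lambda>j. g j P) ` J)))" for P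
    using insert.hyps(1) by (simp add: insert_commute[of "f P"])
  then show ?case using insert by (simp add: continuous_on_max)
qed simp

lemma Max_insert_mono:
  fixes a :: real
  assumes "finite J" "a \<le> b" "\<And>j. j \<in> J \<Longrightarrow> f j \<le> g j"
  shows "Max (insert a (f ` J)) \<le> Max (insert b (g ` J))"
proof -
  have ge: "v \<le> Max (insert b (g ` J))" if "v \<in> insert b (g ` J)" for v
    using assms(1) that by (intro Max_ge) auto
  show ?thesis
  proof (rule Max.boundedI)
    fix v assume "v \<in> insert a (f ` J)"
    then consider "v = a" | j where "j \<in> J" "v = f j" by blast
    then show "v \<le> Max (insert b (g ` J))"
    proof cases
      case 1
      then show ?thesis using ge[of b] assms(2) by simp
    next
      case 2
      then show ?thesis using ge[of "g j"] assms(3)[of j] by simp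
    qed
  qed (use assms(1) in auto)
qed

context smoothed_path
begin

text \<open>
  The time that an exponential relaxation needs to cover the fraction \<open>c\<close> of a jump, except
  that \<open>c\<close> is shrunk by the factor \<open>1 - exp (- lam h)\<close> so that the whole jump takes the finite time \<open>h\<close>.
\<close>

definition catch_up :: "real \<Rightarrow> real \<Rightarrow> real" where
  "catch_up h c = - ln (1 - c * (1 - exp (- lam * h))) / lam"

lemma catch_up:
  assumes "0 < h" "c \<in> {0..1}"
  shows "exp (- lam * catch_up h c) = 1 - c * (1 - exp (- lam * h))"
    and "0 \<le> catch_up h c" "catch_up h c \<le> h"
proof -
  define k where "k = exp (- lam * h)"
  have k: "0 < k" "k < 1" using assms lam by (auto simp: k_def)
  have "c * (1 - k) \<le> 1 * (1 - k)" "0 \<le> c * (1 - k)" using assms k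
    by (auto intro!: mult_right_mono mult_nonneg_nonneg simp del: mult_1)
  then have r: "k \<le> 1 - c * (1 - k)" "1 - c * (1 - k) \<le> 1" by auto
  then have pos: "0 < 1 - c * (1 - k)" using k by linarith
  show "exp (- lam * catch_up h c) = 1 - c * (1 - exp (- lam * h))"
    using pos lam unfolding catch_up_def k_def[symmetric] by simp
  have "ln (1 - c * (1 - k)) \<le> 0" using r pos by simp
  then show "0 \<le> catch_up h c"
    unfolding catch_up_def k_def[symmetric] using lam by (simp add: divide_nonpos_pos)
  have "ln k \<le> ln (1 - c * (1 - k))" using r k pos by simp
  then have "- lam * h \<le> ln (1 - c * (1 - k))" by (simp add: k_def)
  then show "catch_up h c \<le> h"
    unfolding catch_up_def k_def[symmetric] using lam by (simp add: field_simps)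
qed

lemma catch_up_0_1: "catch_up h 0 = 0" "catch_up h 1 = h"
  using lam by (auto simp: catch_up_def)

lemma catch_up_mono:
  assumes "0 < h" "c \<in> {0..1}" "c' \<in> {0..1}" "c \<le> c'"
  shows "catch_up h c \<le> catch_up h c'"
proof -
  have "exp (- lam * catch_up h c') \<le> exp (- lam * catch_up h c)"
    using catch_up(1)[OF assms(1,2)] catch_up(1)[OF assms(1,3)] assms lam
    by (simp add: mult_right_mono)
  then show ?thesis using lam by simp
qed

lemma continuous_on_catch_up:
  assumes "0 < h"
  shows "continuous_on {0..1} (catch_up h)"
proof -
  have "1 - c * (1 - exp (- lam * h)) \<noteq> 0" if "c \<in> {0..1}" for c
    using catch_up(1)[OF assms that] by (metis exp_not_eq_zero)
  then show ?thesis
    unfolding catch_up_def using lam by (intro continuous_intros) auto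
qed

text \<open>
  The tolerance adds up as follows. Away from large jumps \<open>x\<close> varies by at most \<open>4 e\<close> on windows of
  length \<open>h\<close>, and \<open>y\<close> enters a large jump within \<open>8 e\<close> of the left limit. On the vertical segment
  the relaxation estimate contributes another \<open>4 e\<close>, and the part of the jump
  not yet covered after time \<open>h\<close> a last \<open>e\<close>. The assumption \<open>good\<close> keeps the horizon out
  of the windows in which \<open>y\<close> has not caught up.
\<close>

lemma m1_dist_upto_smoothed:
  assumes e: "0 < e" and h: "0 < h" "h < d" "h \<le> e" and T: "0 < T" "T < K"
    and tp: "three_point_bound K d e x"
    and B: "\<And>s. 0 \<le> s \<Longrightarrow> s < K \<Longrightarrow> \<bar>x s\<bar> \<le> B"
    and fast: "exp (- lam * h) * (2 * B) \<le> e"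
    and good: "\<And>\<tau>. 0 < \<tau> \<Longrightarrow> \<tau> \<le> T \<Longrightarrow> 2 * e < \<bar>jump x \<tau>\<bar> \<Longrightarrow> \<tau> + h \<le> T"
  shows "m1_dist_upto T y x \<le> 13 * e"
proof -
  let ?G = "completed_graph x T"
  have T0: "0 \<le> T" using T by simp
  note inG = completed_graph_iff[OF T0]
  define k where "k = exp (- lam * h)"
  have k: "0 < k" "k < 1" using h lam by (auto simp: k_def)
  define J where "J = {\<tau> \<in> {0<..T}. 2 * e < \<bar>jump x \<tau>\<bar>}"
  have finJ: "finite J"
    unfolding J_def using large_jumps_finite(1)[OF cadlag tp e _ T(2)] h by simp
  have sep: "d \<le> t2 - t1" if "t1 \<in> J" "t2 \<in> J" "t1 < t2" for t1 t2
    using large_jumps_separated[OF cadlag tp e, of t1 t2] that T unfolding J_def by force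
  have flat: "\<bar>x t - x r\<bar> \<le> 4 * e"
    if "0 \<le> r" "r \<le> t" "t \<le> T" "t - r \<le> h" "\<And>s. s \<in> J \<Longrightarrow> r < s \<Longrightarrow> s \<le> t \<Longrightarrow> False" for r t
  proof (rule three_point_bound_small_jumps[OF cadlag tp])
    show "\<bar>jump x s\<bar> \<le> 2 * e" if "r < s" "s \<le> t" for s
      using \<open>\<And>s. s \<in> J \<Longrightarrow> r < s \<Longrightarrow> s \<le> t \<Longrightarrow> False\<close>[of s] that \<open>0 \<le> r\<close> \<open>t \<le> T\<close>
      unfolding J_def by force
  qed (use that T h e in auto)
  have llB: "\<bar>left_lim x t\<bar> \<le> B" if "0 < t" "t \<le> T" for t
    using left_lim_between[OF cadlag that(1) that(1), of 0 B] B that T by auto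
  have forget: "k * \<bar>y r - b\<bar> \<le> e" if "0 \<le> r" "r \<le> T" "\<bar>b\<bar> \<le> B" for r b
  proof -
    have "\<bar>y r\<bar> \<le> B" by (rule y_bounded[OF B]) (use that T in auto)
    then have "k * \<bar>y r - b\<bar> \<le> k * (2 * B)" using that k by (intro mult_left_mono) auto
    also have "\<dots> \<le> e" using fast unfolding k_def .
    finally show ?thesis .
  qed
  have before: "\<bar>y t - left_lim x t\<bar> \<le> 8 * e"
    if t: "0 < t" "t \<le> T" and no: "\<And>s. s \<in> J \<Longrightarrow> t - h < s \<Longrightarrow> s < t \<Longrightarrow> False" for t
  proof -
    \<comment> \<open>either \<open>y\<close> had the time \<open>h\<close> to relax, or the window reaches back to the common start \<open>0\<close>\<close>
    define r where "r = max 0 (t - h)"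
    have r: "0 \<le> r" "r < t" "t - h \<le> r" using t h by (auto simp: r_def)
    have near: "\<bar>x s - left_lim x t\<bar> \<le> 4 * e" if s: "r \<le> s" "s < t" for s
    proof -
      have "\<bar>left_lim x t - x s\<bar> \<le> 4 * e"
      proof (rule left_lim_between[OF cadlag t(1) s(2)])
        fix q assume q: "s < q" "q < t"
        show "\<bar>x q - x s\<bar> \<le> 4 * e"
          by (rule flat) (use q s r t no in \<open>force+\<close>)
      qed
      then show ?thesis by linarith
    qed
    have rel: "\<bar>y t - left_lim x t - exp (- lam * (t - r)) * (y r - left_lim x t)\<bar> \<le> 4 * e"
      by (rule relax) (use r near e in auto)
    have "\<bar>exp (- lam * (t - r)) * (y r - left_lim x t)\<bar> \<le> 4 * e"
    proof (cases "h \<le> t")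
      case True
      then have "t - r = h" using h by (simp add: r_def)
      then show ?thesis using forget[of r "left_lim x t"] llB[OF t] r t e
        by (simp add: abs_mult k_def)
    next
      case False
      then have "r = 0" by (simp add: r_def)
      then have "\<bar>left_lim x t\<bar> \<le> 4 * e" using near[of 0] t start by simp
      moreover have "exp (- lam * (t - r)) \<le> 1" using lam r by simp
      ultimately have "exp (- lam * (t - r)) * \<bar>left_lim x t\<bar> \<le> 1 * (4 * e)"
        by (intro mult_mono) auto
      then show ?thesis using y_start \<open>r = 0\<close> by (simp add: abs_mult)
    qed
    then show ?thesis using rel by linarith
  qed
  have flat_after: "\<bar>x s - x \<tau>\<bar> \<le> 4 * e" if \<tau>: "\<tau> \<in> J" and s: "\<tau> \<le> s" "s \<le> T" "s \<le> \<tau> + h" for \<tau> s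
  proof (rule flat)
    fix q assume "q \<in> J" "\<tau> < q" "q \<le> s"
    then show False using sep[OF \<tau>, of q] s h by simp
  qed (use that in \<open>auto simp: J_def\<close>)
  have after: "\<bar>y s - x \<tau> - exp (- lam * (s - \<tau>)) * (y \<tau> - x \<tau>)\<bar> \<le> 4 * e"
    if \<tau>: "\<tau> \<in> J" and s: "\<tau> \<le> s" "s \<le> \<tau> + h" for \<tau> s
  proof (rule relax)
    have "\<tau> + h \<le> T" using good \<tau> unfolding J_def by auto
    then show "\<bar>x q - x \<tau>\<bar> \<le> 4 * e" if "\<tau> \<le> q" "q < s" for q
      using flat_after[OF \<tau>, of q] that s by auto
  qed (use that e in \<open>auto simp: J_def\<close>)

  \<comment> \<open>the time assigned to \<open>P\<close> by the jump at \<open>\<tau>\<close>: the time of \<open>P\<close> before \<open>\<tau>\<close>, and \<open>\<tau> + h\<close> once the jump is completed\<close>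
  define act where "act \<tau> P = min (snd P) \<tau> + catch_up h (jump_frac x \<tau> P)" for \<tau> and P :: "real \<times> real"
  define \<sigma> where "\<sigma> P = Max (insert (snd P) ((\<lambda>\<tau>. act \<tau> P) ` J))" for P
  have act: "snd P < \<tau> \<Longrightarrow> act \<tau> P = snd P" "\<tau> < snd P \<Longrightarrow> act \<tau> P = \<tau> + h" for P \<tau>
    by (auto simp: act_def jump_frac_def catch_up_0_1)
  have frac: "jump_frac x \<tau> P \<in> {0..1}" if "P \<in> ?G" "\<tau> \<in> J" for P \<tau>
    by (rule jump_frac_range[OF that(1) T0]) (use that in \<open>auto simp: J_def\<close>)
  have \<sigma>_idle: "\<sigma> P = snd P" if no: "\<And>\<tau>. \<tau> \<in> J \<Longrightarrow> \<tau> \<le> snd P \<Longrightarrow> \<tau> + h \<le> snd P" for P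
    unfolding \<sigma>_def
  proof (rule Max_eqI)
    fix v assume "v \<in> insert (snd P) ((\<lambda>\<tau>. act \<tau> P) ` J)"
    moreover have "act \<tau> P \<le> snd P" if "\<tau> \<in> J" for \<tau>
      using no[OF that] act[where P = P and \<tau> = \<tau>] h by (cases "snd P < \<tau>") auto
    ultimately show "v \<le> snd P" by auto
  qed (use finJ in auto)
  have \<sigma>_busy: "\<sigma> P = act \<tau> P" if P: "P \<in> ?G" and \<tau>: "\<tau> \<in> J" "\<tau> \<le> snd P" "snd P < \<tau> + h" for P \<tau>
    unfolding \<sigma>_def
  proof (rule Max_eqI)
    have ge: "snd P \<le> act \<tau> P"
    proof (cases "snd P = \<tau>")
      case True
      then show ?thesis using catch_up(2)[OF h(1) frac[OF P \<tau>(1)]] by (simp add: act_def)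
    qed (use act[where P = P and \<tau> = \<tau>] \<tau> in simp)
    fix v assume "v \<in> insert (snd P) ((\<lambda>\<tau>. act \<tau> P) ` J)"
    moreover have "act t P \<le> act \<tau> P" if "t \<in> J" for t
    proof (cases t \<tau> rule: linorder_cases)
      case less
      then show ?thesis using sep[OF that \<tau>(1)] act(2)[of t P] \<tau> ge h by linarith
    next
      case greater
      then show ?thesis using sep[OF \<tau>(1) that] act(1)[of P t] \<tau> ge h by linarith
    qed simp
    ultimately show "v \<le> act \<tau> P" using ge by auto
  qed (use finJ \<tau> in auto)

  have close: "\<bar>y (\<sigma> P) - fst P\<bar> \<le> 13 * e \<and> \<bar>\<sigma> P - snd P\<bar> \<le> h" if P: "P \<in> ?G" for P
  proof -
    define z where "z = fst P"
    define t where "t = snd P"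
    have zt: "0 \<le> t" "t \<le> T" "z \<in> fibre x t" using P inG[of P] by (auto simp: z_def t_def)
    consider (idle) "\<And>\<tau>. \<tau> \<in> J \<Longrightarrow> \<tau> \<le> t \<Longrightarrow> \<tau> + h \<le> t"
      | (busy) \<tau> where "\<tau> \<in> J" "\<tau> \<le> t" "t < \<tau> + h" by force
    then show ?thesis
    proof cases
      case idle
      then have s: "\<sigma> P = t" using \<sigma>_idle[of P] by (simp add: t_def)
      have "\<bar>y t - z\<bar> \<le> 10 * e"
      proof (cases "t = 0")
        case True
        then show ?thesis using zt y_start start e by (simp add: fibre_def)
      next
        case False
        then have "t \<notin> J" using idle[of t] h by auto
        then have "\<bar>jump x t\<bar> \<le> 2 * e" using False zt by (auto simp: J_def)
        then have "\<bar>z - left_lim x t\<bar> \<le> 2 * e" using fibre_dist_le_jump[OF zt(3) False] by linarith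
        moreover have "\<bar>y t - left_lim x t\<bar> \<le> 8 * e"
          by (rule before) (use False zt idle in force)+
        ultimately show ?thesis by linarith
      qed
      then show ?thesis using s e h by (simp add: z_def t_def)
    next
      case (busy \<tau>)
      have s: "\<sigma> P = act \<tau> P" using \<sigma>_busy[OF P busy(1)] busy by (simp add: t_def)
      have \<tau>: "0 < \<tau>" "\<tau> \<le> T" "2 * e < \<bar>jump x \<tau>\<bar>" using busy(1) by (auto simp: J_def)
      define a where "a = left_lim x \<tau>"
      define b where "b = x \<tau>"
      have bB: "\<bar>b\<bar> \<le> B" using B[of \<tau>] \<tau> T by (simp add: b_def)
      show ?thesis
      proof (cases "t = \<tau>")
        case True
        define c where "c = jump_frac x \<tau> P"
        have c: "c \<in> {0..1}" using frac[OF P busy(1)] by (simp add: c_def)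
        have s': "\<sigma> P = \<tau> + catch_up h c" using s True by (simp add: act_def c_def t_def)
        note cu = catch_up[OF h(1) c]
        have zc: "z = a + c * (b - a)"
        proof -
          have ab: "a \<noteq> b" using \<tau>(3) e by (auto simp: a_def b_def)
          have "c * \<bar>b - a\<bar> = \<bar>a - z\<bar>"
            using True ab by (simp add: c_def jump_frac_def a_def b_def z_def t_def)
          moreover have "z \<in> closed_segment a b"
            using zt(3) True \<tau> by (simp add: fibre_def a_def b_def)
          ultimately show ?thesis
            by (auto simp: closed_segment_eq_real_ivl abs_if algebra_simps split: if_splits)
        qed
        have ya: "\<bar>y \<tau> - a\<bar> \<le> 8 * e"
          unfolding a_def
        proof (rule before[OF \<tau>(1,2)])
          fix q assume "q \<in> J" "\<tau> - h < q" "q < \<tau>"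
          then show False using sep[OF _ busy(1), of q] h by simp
        qed
        have E: "exp (- lam * (\<sigma> P - \<tau>)) = 1 - c * (1 - k)"
          using cu(1) by (simp add: s' k_def)
        have "\<bar>y (\<sigma> P) - b - exp (- lam * (\<sigma> P - \<tau>)) * (y \<tau> - b)\<bar> \<le> 4 * e"
          unfolding b_def by (rule after[OF busy(1)]) (use s' cu in auto)
        then have 1: "\<bar>y (\<sigma> P) - b - (1 - c * (1 - k)) * (y \<tau> - b)\<bar> \<le> 4 * e"
          unfolding E .
        have 2: "\<bar>(1 - c) * (y \<tau> - a)\<bar> \<le> 8 * e"
        proof -
          have "(1 - c) * \<bar>y \<tau> - a\<bar> \<le> 1 * (8 * e)" using c ya by (intro mult_mono) auto
          then show ?thesis using c by (simp add: abs_mult)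
        qed
        have 3: "\<bar>c * (k * (y \<tau> - b))\<bar> \<le> e"
        proof -
          have "c * (k * \<bar>y \<tau> - b\<bar>) \<le> 1 * e"
            using c forget[of \<tau> b] \<tau> bB k by (intro mult_mono) auto
          then show ?thesis using c k by (simp add: abs_mult)
        qed
        have "y (\<sigma> P) - z = (y (\<sigma> P) - b - (1 - c * (1 - k)) * (y \<tau> - b))
            + (1 - c) * (y \<tau> - a) + c * (k * (y \<tau> - b))"
          by (simp add: zc algebra_simps)
        then have "\<bar>y (\<sigma> P) - z\<bar> \<le> 13 * e" using 1 2 3 by linarith
        moreover have "\<bar>\<sigma> P - t\<bar> \<le> h" using s' cu True by simp
        ultimately show ?thesis by (simp add: z_def t_def)
      next
        case False
        then have lt: "\<tau> < t" using busy by simp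
        then have s': "\<sigma> P = \<tau> + h" using s act(2)[of \<tau> P] by (simp add: t_def)
        have "\<bar>y (\<tau> + h) - b - k * (y \<tau> - b)\<bar> \<le> 4 * e"
          using after[OF busy(1), of "\<tau> + h"] h by (simp add: k_def b_def)
        moreover have "\<bar>k * (y \<tau> - b)\<bar> \<le> e"
          using forget[of \<tau> b] \<tau> bB k by (simp add: abs_mult)
        ultimately have y: "\<bar>y (\<tau> + h) - b\<bar> \<le> 5 * e" by linarith
        have "\<bar>z - b\<bar> \<le> 4 * e"
        proof (rule fibre_near[OF zt(3)])
          show "\<bar>x t - b\<bar> \<le> 4 * e"
            unfolding b_def using flat_after[OF busy(1), of t] busy zt by simp
          show "\<bar>left_lim x t - b\<bar> \<le> 4 * e" if "0 < t"
          proof (rule left_lim_between[OF cadlag that lt])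
            show "\<bar>x q - b\<bar> \<le> 4 * e" if "\<tau> < q" "q < t" for q
              unfolding b_def using flat_after[OF busy(1), of q] that busy zt by simp
          qed
        qed (rule zt(1))
        then have "\<bar>y (\<tau> + h) - z\<bar> \<le> 13 * e" using y e by linarith
        then show ?thesis using s' lt busy by (simp add: z_def t_def)
      qed
    qed
  qed

  show ?thesis
  proof (rule m1_dist_upto_le[OF cadlag T(1) y_continuous])
    show "continuous_on ?G \<sigma>"
      unfolding \<sigma>_def act_def
    proof (rule continuous_on_Max_insert[OF finJ])
      fix \<tau> assume \<tau>: "\<tau> \<in> J"
      have "continuous_on ?G (jump_frac x \<tau>)"
        by (rule continuous_on_jump_frac[OF cadlag T0]) (use \<tau> e in \<open>auto simp: J_def\<close>)
      then have "continuous_on ?G (\<lambda>P. catch_up h (jump_frac x \<tau> P))"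
        by (rule continuous_on_compose2[OF continuous_on_catch_up[OF h(1)]]) (use frac \<tau> in blast)
      then show "continuous_on ?G (\<lambda>P. min (snd P) \<tau> + catch_up h (jump_frac x \<tau> P))"
        by (intro continuous_intros)
    qed (intro continuous_intros)
    show "\<sigma> P \<le> \<sigma> Q" if PQ: "P \<in> ?G" "Q \<in> ?G" "graph_le x P Q" for P Q
    proof -
      have le: "snd P \<le> snd Q" using PQ(3) by (auto simp: graph_le_iff)
      show ?thesis
        unfolding \<sigma>_def
      proof (rule Max_insert_mono[OF finJ le])
        fix \<tau> assume \<tau>: "\<tau> \<in> J"
        have "jump_frac x \<tau> P \<le> jump_frac x \<tau> Q"
          by (rule jump_frac_mono[OF PQ(1,2) T0 _ PQ(3)]) (use \<tau> in \<open>simp add: J_def\<close>)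
        then have "catch_up h (jump_frac x \<tau> P) \<le> catch_up h (jump_frac x \<tau> Q)"
          by (intro catch_up_mono h frac PQ \<tau>)
        then show "act \<tau> P \<le> act \<tau> Q" unfolding act_def using le by (simp add: min_def) 
      qed
    qed
    show "\<sigma> (x 0, 0) = 0"
      using \<sigma>_idle[of "(x 0, 0)"] by (force simp: J_def)
    show "\<sigma> (x T, T) = T"
      using \<sigma>_idle[of "(x T, T)"] good by (force simp: J_def)
    show "\<bar>y (\<sigma> P) - fst P\<bar> \<le> 13 * e" "\<bar>\<sigma> P - snd P\<bar> \<le> 13 * e" if "P \<in> ?G" for P
      using close[OF that] h e by auto
  qed
qed

end

section \<open>Averaging over the time horizon\<close>

lemma has_bochner_integral_exp_minus_atLeast:
  "has_bochner_integral lborel (\<lambda>T::real. exp (- T) * indicator {a..} T) (exp (- a))"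
proof (rule has_bochner_integral_nn_integral)
  have "((\<lambda>T::real. - exp (- T)) \<longlongrightarrow> - 0) at_top"
    by (intro tendsto_minus filterlim_compose[OF exp_at_bot] filterlim_uminus_at_bot_at_top)
  then have lim: "((\<lambda>T::real. - exp (- T)) \<longlongrightarrow> 0) at_top" by simp
  have "(\<integral>\<^sup>+ T. ennreal (exp (- T)) * indicator {a..} T \<partial>lborel) = ennreal (0 - - exp (- a))"
    by (rule nn_integral_FTC_atLeast[OF _ _ _ lim]) (auto intro!: derivative_eq_intros)
  then show "(\<integral>\<^sup>+ T. ennreal (exp (- T) * indicator {a..} T) \<partial>lborel) = ennreal (exp (- a))"
    by (simp add: ennreal_mult' ennreal_indicator)
qed auto

context smoothed_path
begin

text \<open>
  Horizons beyond \<open>K\<close> contribute at most \<open>exp (- K)\<close>, the windows after the large jumps at most their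
  total length, which the separation of large jumps bounds, and all other horizons at most \<open>13 e\<close>.
  Path bounds are assumed up to \<open>K + 1\<close> so that jumps at times up to and including \<open>K\<close> are covered.
\<close>

lemma m1_dist_smoothed:
  assumes e: "0 < e" and h: "0 < h" "h < d" "h \<le> e" "h * ((K + 1) / d + 1) \<le> e"
    and K: "0 < K" "exp (- K) \<le> e"
    and tp: "three_point_bound (K + 1) d e x"
    and B: "\<And>s. 0 \<le> s \<Longrightarrow> s < K + 1 \<Longrightarrow> \<bar>x s\<bar> \<le> B"
    and fast: "exp (- lam * h) * (2 * B) \<le> e"
  shows "m1_dist y x \<le> 15 * e"
proof -
  define J where "J = {\<tau> \<in> {0<..K}. 2 * e < \<bar>jump x \<tau>\<bar>}"
  have d: "0 < d" using h by simp
  have finJ: "finite J" and cardJ: "real (card J) \<le> (K + 1) / d + 1"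
    unfolding J_def using large_jumps_finite[OF cadlag tp e d, of K] K by auto
  define g where "g T = 13 * e * (exp (- T) * indicator {0..} T)
    + (\<Sum>\<tau>\<in>J. indicator {\<tau>..\<tau> + h} T) + exp (- T) * indicator {K..} T" for T :: real
  have "has_bochner_integral lborel (indicator {\<tau>..\<tau> + h} :: real \<Rightarrow> real) h" for \<tau>
    using has_bochner_integral_real_indicator[of "{\<tau>..\<tau> + h}" lborel] h by simp
  then have "has_bochner_integral lborel g (13 * e * exp (- 0) + (\<Sum>\<tau>\<in>J. h) + exp (- K))"
    unfolding g_def
    by (intro has_bochner_integral_add has_bochner_integral_mult_right has_bochner_integral_sum
        has_bochner_integral_exp_minus_atLeast)
  then have gi: "integrable lborel g" and gv: "integral\<^sup>L lborel g = 13 * e + card J * h + exp (- K)"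
    by (auto simp: has_bochner_integral_iff)
  have g0: "0 \<le> g T" for T
    unfolding g_def using e by (intro add_nonneg_nonneg mult_nonneg_nonneg sum_nonneg) auto
  have le: "indicator {0<..} T *\<^sub>R (exp (- T) * min 1 (m1_dist_upto T y x)) \<le> g T" for T
  proof (cases "0 < T")
    case True
    have sum0: "0 \<le> (\<Sum>\<tau>\<in>J. indicator {\<tau>..\<tau> + h} T :: real)" by (intro sum_nonneg) auto
    have m: "exp (- T) * min 1 (m1_dist_upto T y x) \<le> exp (- T)" by simp
    have lhs: "indicator {0<..} T *\<^sub>R (exp (- T) * min 1 (m1_dist_upto T y x))
        = exp (- T) * min 1 (m1_dist_upto T y x)"
      using True by simp
    consider "K \<le> T" | \<tau> where "T < K" "\<tau> \<in> J" "\<tau> \<le> T" "T < \<tau> + h"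
      | "T < K" "\<And>\<tau>. \<tau> \<in> J \<Longrightarrow> \<tau> \<le> T \<Longrightarrow> \<tau> + h \<le> T" by force
    then show ?thesis
    proof cases
      case 1
      have "0 \<le> 13 * e * exp (- T)" using e by simp
      moreover have "g T = 13 * e * exp (- T) + (\<Sum>\<tau>\<in>J. indicator {\<tau>..\<tau> + h} T) + exp (- T)"
        using 1 True by (simp add: g_def)
      ultimately show ?thesis unfolding lhs using m sum0 by linarith
    next
      case 2
      have "(1::real) = indicator {\<tau>..\<tau> + h} T" using 2 by simp
      also have "\<dots> \<le> (\<Sum>\<tau>\<in>J. indicator {\<tau>..\<tau> + h} T)"
        by (rule member_le_sum[OF 2(2) _ finJ]) auto
      finally have "1 \<le> (\<Sum>\<tau>\<in>J. indicator {\<tau>..\<tau> + h} T :: real)" .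
      moreover have "exp (- T) \<le> 1" using True by simp
      moreover have "0 \<le> 13 * e * exp (- T)" using e by simp
      moreover have "g T = 13 * e * exp (- T) + (\<Sum>\<tau>\<in>J. indicator {\<tau>..\<tau> + h} T)"
        using 2 True by (simp add: g_def)
      ultimately show ?thesis unfolding lhs using m by linarith
    next
      case 3
      have "m1_dist_upto T y x \<le> 13 * e"
      proof (rule m1_dist_upto_smoothed[OF e h(1-3) True _ tp B fast])
        show "\<tau> + h \<le> T" if "0 < \<tau>" "\<tau> \<le> T" "2 * e < \<bar>jump x \<tau>\<bar>" for \<tau>
          using 3(2)[of \<tau>] 3(1) that by (simp add: J_def)
      qed (use 3 in auto)
      then have "exp (- T) * min 1 (m1_dist_upto T y x) \<le> exp (- T) * (13 * e)"
        by (intro mult_left_mono) auto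
      moreover have "g T = exp (- T) * (13 * e) + (\<Sum>\<tau>\<in>J. indicator {\<tau>..\<tau> + h} T)"
        using 3 True by (simp add: g_def mult_ac)
      ultimately show ?thesis unfolding lhs using sum0 by linarith
    qed
  qed (use g0[of T] in simp)
  have "m1_dist y x \<le> integral\<^sup>L lborel g"
    unfolding m1_dist_def set_lebesgue_integral_def
    by (rule integral_mono'[OF gi le g0])
  also have "\<dots> \<le> 15 * e"
  proof -
    have "card J * h \<le> ((K + 1) / d + 1) * h"
      using cardJ h by (intro mult_right_mono) auto
    then show ?thesis using gv K h(4) by (simp add: mult.commute)
  qed
  finally show ?thesis .
qed

end

section \<open>Measurability of the oscillation bounds\<close>

text \<open>
  A violation of the bound is an open condition on the three values. It therefore survives a move
  of the three times to rational ones on their right.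
\<close>

lemma three_point_bound_rat:
  assumes "cadlag x" and e: "0 \<le> e"
  shows "three_point_bound K d e x \<longleftrightarrow>
    (\<forall>r s t :: rat. 0 \<le> r \<and> r \<le> s \<and> s \<le> t \<and> of_rat t < K \<and> of_rat t - of_rat r < d \<longrightarrow>
       \<bar>x (of_rat s) - x (of_rat r)\<bar> \<le> e \<or> \<bar>x (of_rat t) - x (of_rat s)\<bar> \<le> e)"
    (is "_ \<longleftrightarrow> ?rhs")
proof
  assume "three_point_bound K d e x"
  then show ?rhs unfolding three_point_bound_def by (simp add: of_rat_less_eq)
next
  assume R: ?rhs
  show "three_point_bound K d e x"
    unfolding three_point_bound_def
  proof (intro allI impI, rule ccontr)
    fix r s t assume *: "0 \<le> r \<and> r \<le> s \<and> s \<le> t \<and> t < K \<and> t - r < d"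
      and "\<not> (\<bar>x s - x r\<bar> \<le> e \<or> \<bar>x t - x s\<bar> \<le> e)"
    then have big: "e < \<bar>x s - x r\<bar>" "e < \<bar>x t - x s\<bar>" by auto
    then have "r \<noteq> s" "s \<noteq> t" using e by auto
    have o: "r < s" "s < t" using * \<open>r \<noteq> s\<close> \<open>s \<noteq> t\<close> by auto
    define m where "m = min (\<bar>x s - x r\<bar> - e) (\<bar>x t - x s\<bar> - e) / 2"
    have m: "0 < m" using big by (simp add: m_def)
    obtain h1 where h1: "0 < h1" "\<And>q. r \<le> q \<Longrightarrow> q < r + h1 \<Longrightarrow> \<bar>x q - x r\<bar> < m"
      using cadlag_near_right[OF assms(1) _ m, of r] * by auto
    obtain h2 where h2: "0 < h2" "\<And>q. s \<le> q \<Longrightarrow> q < s + h2 \<Longrightarrow> \<bar>x q - x s\<bar> < m"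
      using cadlag_near_right[OF assms(1) _ m, of s] * by auto
    obtain h3 where h3: "0 < h3" "\<And>q. t \<le> q \<Longrightarrow> q < t + h3 \<Longrightarrow> \<bar>x q - x t\<bar> < m"
      using cadlag_near_right[OF assms(1) _ m, of t] * by auto
    obtain r' :: rat where r': "r < of_rat r'" "of_rat r' < min s (r + h1)"
      using of_rat_dense[of r "min s (r + h1)"] o h1 by auto
    obtain s' :: rat where s': "s < of_rat s'" "of_rat s' < min t (s + h2)"
      using of_rat_dense[of s "min t (s + h2)"] o h2 by auto
    obtain t' :: rat where t': "t < of_rat t'" "of_rat t' < min K (min (r + d) (t + h3))"
      using of_rat_dense[of t "min K (min (r + d) (t + h3))"] * h3 by auto
    have "0 \<le> (of_rat r' :: real)" "(of_rat r' :: real) \<le> of_rat s'"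
      "(of_rat s' :: real) \<le> of_rat t'"
      using r' s' t' * by linarith+
    then have "0 \<le> r'" "r' \<le> s'" "s' \<le> t'" by (simp_all add: of_rat_less_eq)
    moreover have "of_rat t' < K" "of_rat t' - of_rat r' < d" using r' t' by auto
    ultimately have "\<bar>x (of_rat s') - x (of_rat r')\<bar> \<le> e \<or> \<bar>x (of_rat t') - x (of_rat s')\<bar> \<le> e"
      using R by blast
    moreover have "\<bar>x (of_rat r') - x r\<bar> < m" using h1(2)[of "of_rat r'"] r' by auto
    moreover have "\<bar>x (of_rat s') - x s\<bar> < m" using h2(2)[of "of_rat s'"] s' by auto
    moreover have "\<bar>x (of_rat t') - x t\<bar> < m" using h3(2)[of "of_rat t'"] t' by auto
    moreover have "2 * m \<le> \<bar>x s - x r\<bar> - e" "2 * m \<le> \<bar>x t - x s\<bar> - e" by (auto simp: m_def)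
    ultimately show False by linarith
  qed
qed

lemma bounded_path_rat:
  assumes "cadlag x"
  shows "(\<forall>s. 0 \<le> s \<and> s < K \<longrightarrow> \<bar>x s\<bar> \<le> B) \<longleftrightarrow>
    (\<forall>s :: rat. 0 \<le> s \<and> of_rat s < K \<longrightarrow> \<bar>x (of_rat s)\<bar> \<le> B)" (is "?lhs \<longleftrightarrow> ?rhs")
proof
  assume R: ?rhs
  show ?lhs
  proof (intro allI impI, rule ccontr)
    fix s assume s: "0 \<le> s \<and> s < K" and "\<not> \<bar>x s\<bar> \<le> B"
    then have m: "0 < \<bar>x s\<bar> - B" by simp
    obtain h where h: "0 < h" "\<And>q. s \<le> q \<Longrightarrow> q < s + h \<Longrightarrow> \<bar>x q - x s\<bar> < \<bar>x s\<bar> - B"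
      using cadlag_near_right[OF assms _ m, of s] s by auto
    obtain q :: rat where q: "s < of_rat q" "of_rat q < min K (s + h)"
      using of_rat_dense[of s "min K (s + h)"] s h by auto
    have "0 \<le> (of_rat q :: real)" using s q by linarith
    then have "0 \<le> q" by simp
    then have "\<bar>x (of_rat q)\<bar> \<le> B" using R q by simp
    moreover have "\<bar>x (of_rat q) - x s\<bar> < \<bar>x s\<bar> - B" using h(2)[of "of_rat q"] q by simp
    ultimately show False by linarith
  qed
qed simp

lemma sets_three_point_bound_and_bounded:
  assumes meas: "\<And>t. 0 \<le> t \<Longrightarrow> L t \<in> borel_measurable M"
    and cad: "\<And>\<omega>. \<omega> \<in> space M \<Longrightarrow> cadlag (\<lambda>t. L t \<omega>)" and e: "0 \<le> e"
  shows "{\<omega> \<in> space M. three_point_bound K d e (\<lambda>t. L t \<omega>) \<and>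
     (\<forall>s. 0 \<le> s \<and> s < K \<longrightarrow> \<bar>L s \<omega>\<bar> \<le> B)} \<in> sets M" (is "?S \<in> _")
proof -
  have m: "L (of_rat r) \<in> borel_measurable M" if "0 \<le> r" for r :: rat
    by (rule meas) (use that in simp)
  have 1: "Measurable.pred M (\<lambda>\<omega>. \<forall>r s t :: rat.
      0 \<le> r \<and> r \<le> s \<and> s \<le> t \<and> of_rat t < K \<and> of_rat t - of_rat r < d \<longrightarrow>
       \<bar>L (of_rat s) \<omega> - L (of_rat r) \<omega>\<bar> \<le> e \<or> \<bar>L (of_rat t) \<omega> - L (of_rat s) \<omega>\<bar> \<le> e)"
  proof (intro pred_intros_countable pred_intros_imp')
    fix r s t :: rat
    assume "0 \<le> r \<and> r \<le> s \<and> s \<le> t \<and> of_rat t < K \<and> of_rat t - of_rat r < d"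
    then have [measurable]: "L (of_rat r) \<in> borel_measurable M" "L (of_rat s) \<in> borel_measurable M"
      "L (of_rat t) \<in> borel_measurable M"
      by (auto intro!: m)
    show "Measurable.pred M (\<lambda>\<omega>. \<bar>L (of_rat s) \<omega> - L (of_rat r) \<omega>\<bar> \<le> e \<or> \<bar>L (of_rat t) \<omega> - L (of_rat s) \<omega>\<bar> \<le> e)"
      by measurable
  qed
  have 2: "Measurable.pred M (\<lambda>\<omega>. \<forall>s :: rat. 0 \<le> s \<and> of_rat s < K \<longrightarrow> \<bar>L (of_rat s) \<omega>\<bar> \<le> B)"
  proof (intro pred_intros_countable pred_intros_imp')
    fix s :: rat
    assume "0 \<le> s \<and> of_rat s < K"
    then have [measurable]: "L (of_rat s) \<in> borel_measurable M" by (auto intro!: m)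
    show "Measurable.pred M (\<lambda>\<omega>. \<bar>L (of_rat s) \<omega>\<bar> \<le> B)" by measurable
  qed
  have "?S = {\<omega> \<in> space M.
     (\<forall>r s t :: rat. 0 \<le> r \<and> r \<le> s \<and> s \<le> t \<and> of_rat t < K \<and> of_rat t - of_rat r < d \<longrightarrow>
       \<bar>L (of_rat s) \<omega> - L (of_rat r) \<omega>\<bar> \<le> e \<or> \<bar>L (of_rat t) \<omega> - L (of_rat s) \<omega>\<bar> \<le> e) \<and>
     (\<forall>s :: rat. 0 \<le> s \<and> of_rat s < K \<longrightarrow> \<bar>L (of_rat s) \<omega>\<bar> \<le> B)}"
    by (intro Collect_cong conj_cong refl three_point_bound_rat bounded_path_rat cad e)
  also have "\<dots> \<in> sets M"
    unfolding pred_def[symmetric] by (intro pred_intros_logic 1 2)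
  finally show ?thesis .
qed

section \<open>Convergence in probability\<close>

lemma three_point_bound_mono:
  "three_point_bound K d e x \<Longrightarrow> d' \<le> d \<Longrightarrow> three_point_bound K d' e x"
  unfolding three_point_bound_def by (meson less_le_trans)

lemma smoothed_pathI:
  assumes "cadlag x" "x 0 = 0" "0 < lam"
    and eq: "\<And>t. 0 \<le> t \<Longrightarrow> set_integrable lborel {0..t} v \<and>
      v t = - lam * (LINT s:{0..t}|lborel. v s) + x t \<and> y t = lam * (LINT s:{0..t}|lborel. v s)"
  shows "smoothed_path x y lam"
proof
  fix t :: real assume t: "0 \<le> t"
  have v: "v s = x s - y s" if "0 \<le> s" for s
    using eq[OF that] by simp
  have int: "v integrable_on {0..t}" "(LINT s:{0..t}|lborel. v s) = integral {0..t} v"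
    using set_borel_integral_eq_integral[of "{0..t}" v] eq[OF t] by auto
  show "(\<lambda>s. x s - y s) integrable_on {0..t}"
    by (rule integrable_eq[OF int(1)]) (use v in auto)
  have "integral {0..t} v = integral {0..t} (\<lambda>s. x s - y s)"
    by (rule integral_cong) (use v in auto)
  then show "y t = lam * integral {0..t} (\<lambda>s. x s - y s)"
    using eq[OF t] int(2) by simp
qed (use assms in auto)

theorem theorem3p1:
  fixes M :: "'a measure" and F :: "real \<Rightarrow> 'a measure"
    and L :: "real \<Rightarrow> 'a \<Rightarrow> real" and A :: real
    and V X :: "real \<Rightarrow> real \<Rightarrow> 'a \<Rightarrow> real"
  assumes "usual_filtered_prob_space M F"
    and "levy_process M F L"
    and "A > 0"
    and "\<And>\<gamma>. \<gamma> > 0 \<Longrightarrow> adapted F (V \<gamma>)"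
    and "\<And>\<gamma>. \<gamma> > 0 \<Longrightarrow> adapted F (X \<gamma>)"
    and "\<And>\<gamma>. \<gamma> > 0 \<Longrightarrow> AE \<omega> in M. \<forall>t\<ge>0.
           set_integrable lborel {0..t} (\<lambda>s. V \<gamma> s \<omega>) \<and>
           V \<gamma> t \<omega> = - \<gamma> * A * (LINT s:{0..t}|lborel. V \<gamma> s \<omega>) + L t \<omega> \<and>
           X \<gamma> t \<omega> = \<gamma> * (LINT s:{0..t}|lborel. V \<gamma> s \<omega>)"
  shows "tendsto_in_prob_M1 M (\<lambda>\<gamma> t \<omega>. A * X \<gamma> t \<omega>) L at_top"
  unfolding tendsto_in_prob_M1_def
proof (intro allI impI)
  interpret usual_filtered_prob_space M F by fact
  have cad: "cadlag (\<lambda>t. L t \<omega>)" and L0: "L 0 \<omega> = 0" if "\<omega> \<in> space M" for \<omega>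
    using assms(2) that unfolding levy_process_def by auto
  have meas: "L t \<in> borel_measurable M" if "0 \<le> t" for t
    by (rule measurable_from_subalg[OF sub_F[OF that]])
      (use assms(2) that in \<open>auto simp: levy_process_def adapted_def\<close>)
  fix \<epsilon> :: real assume "0 < \<epsilon>"
  define e where "e = \<epsilon> / 15"
  have e: "0 < e" "15 * e = \<epsilon>" using \<open>0 < \<epsilon>\<close> by (auto simp: e_def)
  define K where "K = max 1 (- ln e)"
  have K: "0 < K" "exp (- K) \<le> e"
  proof -
    have "exp (- K) \<le> exp (ln e)" by (simp add: K_def)
    then show "exp (- K) \<le> e" using e by simp
  qed (simp add: K_def)

  define E where "E n = {\<omega> \<in> space M. three_point_bound (K + 1) (1 / Suc n) e (\<lambda>t. L t \<omega>) \<and>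
     (\<forall>s. 0 \<le> s \<and> s < K + 1 \<longrightarrow> \<bar>L s \<omega>\<bar> \<le> real n)}" for n
  have E: "E n \<in> sets M" for n
    unfolding E_def by (rule sets_three_point_bound_and_bounded[OF meas cad]) (use e in auto)
  have to_Inter: "(\<lambda>n. emeasure M (space M - E n)) \<longlonglongrightarrow> emeasure M (\<Inter>n. space M - E n)"
  proof (rule Lim_emeasure_decseq)
    have "E m \<subseteq> E n" if "m \<le> n" for m n
    proof
      fix \<omega> assume \<omega>: "\<omega> \<in> E m"
      have "three_point_bound (K + 1) (1 / Suc n) e (\<lambda>t. L t \<omega>)"
        by (rule three_point_bound_mono[of _ "1 / Suc m"]) (use \<omega> that in \<open>auto simp: E_def frac_le\<close>)
      moreover have "\<bar>L s \<omega>\<bar> \<le> real n" if "0 \<le> s \<and> s < K + 1" for s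
      proof -
        have "\<bar>L s \<omega>\<bar> \<le> real m" using \<omega> that by (simp add: E_def)
        also have "\<dots> \<le> real n" using \<open>m \<le> n\<close> by simp
        finally show ?thesis .
      qed
      ultimately show "\<omega> \<in> E n" using \<omega> by (simp add: E_def)
    qed
    then show "decseq (\<lambda>n. space M - E n)" unfolding decseq_def by blast
  qed (use E in auto)
  have Inter: "(\<Inter>n. space M - E n) = {}"
  proof -
    have "\<exists>n. \<omega> \<in> E n" if \<omega>: "\<omega> \<in> space M" for \<omega>
    proof -
      obtain d where d: "0 < d" "three_point_bound (K + 1) d e (\<lambda>t. L t \<omega>)"
        using cadlag_imp_three_point_bound[OF cad[OF \<omega>] e(1)] .
      obtain B where B: "0 < B" "\<And>s. 0 \<le> s \<Longrightarrow> s \<le> K + 1 \<Longrightarrow> \<bar>L s \<omega>\<bar> \<le> B"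
        by (rule cadlag_bounded[OF cad[OF \<omega>], where K = "K + 1"]) (rule that)
      obtain n where n: "max (1 / d) B < real n" using reals_Archimedean2 by blast
      have "1 / d \<le> real (Suc n)" using n by simp
      then have "1 / Suc n \<le> d" using d(1) by (simp add: field_simps)
      then have "three_point_bound (K + 1) (1 / Suc n) e (\<lambda>t. L t \<omega>)"
        by (rule three_point_bound_mono[OF d(2)])
      moreover have "\<bar>L s \<omega>\<bar> \<le> real n" if "0 \<le> s \<and> s < K + 1" for s
        using B(2)[of s] n that by simp
      ultimately have "\<omega> \<in> E n" using \<omega> by (simp add: E_def)
      then show ?thesis ..
    qed
    then show ?thesis by blast
  qed
  have lim: "(\<lambda>n. emeasure M (space M - E n)) \<longlonglongrightarrow> 0"
    using to_Inter unfolding Inter by simp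

  have bound: "\<forall>\<^sub>F \<gamma> in at_top. outer_measure_of M
      {\<omega> \<in> space M. m1_dist (\<lambda>t. A * X \<gamma> t \<omega>) (\<lambda>t. L t \<omega>) > \<epsilon>} \<le> emeasure M (space M - E n)" for n
  proof -
    define d where "d = 1 / real (Suc n)"
    \<comment> \<open>\<open>h\<close> is fixed before \<open>\<gamma>\<close>: the windows must be short in total, and only then is \<open>\<gamma>\<close> taken so large that \<open>y\<close> catches up within \<open>h\<close>\<close>
    define h where "h = min (d / 2) (min e (e / ((K + 1) / d + 1)))"
    have d: "0 < d" by (simp add: d_def)
    have q: "0 < (K + 1) / d + 1" using d K by (intro add_pos_pos divide_pos_pos) auto
    have h: "0 < h" "h < d" "h \<le> e" "h * ((K + 1) / d + 1) \<le> e"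
    proof -
      have "h \<le> e / ((K + 1) / d + 1)" by (simp add: h_def)
      then show "h * ((K + 1) / d + 1) \<le> e" using q by (simp only: pos_le_divide_eq)
      show "0 < h" unfolding h_def using d e q by simp
      show "h < d" using d by (simp add: h_def min_def)
      show "h \<le> e" by (simp add: h_def)
    qed
    have "((\<lambda>\<gamma>. exp (- (\<gamma> * A) * h) * (2 * real n)) \<longlongrightarrow> 0 * (2 * real n)) at_top"
      using assms(3) h(1) by (intro tendsto_mult_right) real_asymp
    then have "((\<lambda>\<gamma>. exp (- (\<gamma> * A) * h) * (2 * real n)) \<longlongrightarrow> 0) at_top" by simp
    then have "\<forall>\<^sub>F \<gamma> in at_top. exp (- (\<gamma> * A) * h) * (2 * real n) < e"
      using e(1) by (rule order_tendstoD(2))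
    then show ?thesis
      using eventually_gt_at_top[of 0]
    proof eventually_elim
      case (elim \<gamma>)
      obtain N where N: "N \<in> null_sets M" and sol: "\<And>\<omega> t. \<omega> \<in> space M - N \<Longrightarrow> 0 \<le> t \<Longrightarrow>
           set_integrable lborel {0..t} (\<lambda>s. V \<gamma> s \<omega>) \<and>
           V \<gamma> t \<omega> = - \<gamma> * A * (LINT s:{0..t}|lborel. V \<gamma> s \<omega>) + L t \<omega> \<and>
           X \<gamma> t \<omega> = \<gamma> * (LINT s:{0..t}|lborel. V \<gamma> s \<omega>)"
        using assms(6)[OF elim(2)] by (rule AE_E3) blast
      have "m1_dist (\<lambda>t. A * X \<gamma> t \<omega>) (\<lambda>t. L t \<omega>) \<le> \<epsilon>" if \<omega>: "\<omega> \<in> E n" "\<omega> \<notin> N" for \<omega>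
      proof -
        have sp: "\<omega> \<in> space M" using \<omega> by (simp add: E_def)
        interpret smoothed_path "\<lambda>t. L t \<omega>" "\<lambda>t. A * X \<gamma> t \<omega>" "\<gamma> * A"
          by (rule smoothed_pathI[OF cad L0, where v = "\<lambda>s. V \<gamma> s \<omega>"])
            (use sp \<omega> sol[of \<omega>] elim(2) assms(3) in auto)
        have "m1_dist (\<lambda>t. A * X \<gamma> t \<omega>) (\<lambda>t. L t \<omega>) \<le> 15 * e"
          by (rule m1_dist_smoothed[OF e(1) h K, where B = "real n"])
            (use \<omega> elim(1) in \<open>auto simp: E_def d_def\<close>)
        then show ?thesis using e(2) by simp
      qed
      then have "{\<omega> \<in> space M. m1_dist (\<lambda>t. A * X \<gamma> t \<omega>) (\<lambda>t. L t \<omega>) > \<epsilon>} \<subseteq> (space M - E n) \<union> N"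
        by force
      then have "outer_measure_of M {\<omega> \<in> space M. m1_dist (\<lambda>t. A * X \<gamma> t \<omega>) (\<lambda>t. L t \<omega>) > \<epsilon>}
          \<le> outer_measure_of M ((space M - E n) \<union> N)"
        by (rule outer_measure_of_mono)
      also have "\<dots> = emeasure M ((space M - E n) \<union> N)"
        using E N by (intro outer_measure_of_eq) auto
      also have "\<dots> = emeasure M (space M - E n)"
        using E N by (intro emeasure_Un_null_set) auto
      finally show ?case .
    qed
  qed
  show "((\<lambda>\<gamma>. outer_measure_of M
      {\<omega> \<in> space M. m1_dist (\<lambda>t. A * X \<gamma> t \<omega>) (\<lambda>t. L t \<omega>) > \<epsilon>}) \<longlongrightarrow> 0) at_top"
  proof (rule order_tendstoI)
    fix a :: ennreal assume "0 < a"
    then obtain n where n: "emeasure M (space M - E n) < a"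
      using order_tendstoD(2)[OF lim] eventually_happens'[OF sequentially_bot] by blast
    show "\<forall>\<^sub>F \<gamma> in at_top. outer_measure_of M
        {\<omega> \<in> space M. m1_dist (\<lambda>t. A * X \<gamma> t \<omega>) (\<lambda>t. L t \<omega>) > \<epsilon>} < a"
      using bound[of n] by (rule eventually_mono) (erule le_less_trans[OF _ n])
  qed simp
qed

end
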